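(* There exist a bivariate polynomial $q$ and a constant $C$ such that the following holds for all integers $m,n\ge 1$. Let $\mathbf{A}\in\{0,1\}^{m\times n}$ and $\mathbf{b}\in\{0,1\}^m$, and let $w$ be the maximum number of non-zero components in any of the rows of $\mathbf{A}$. If the system $\mathbf{A}\mathbf{x}=\mathbf{b}$ is unsatisfiable in the two-element field $\mathbb{F}_2$, then the system of linear inequalities $\mathcal{S}(\mathbf{A},\mathbf{b})$ has a (not necessarily tree-like) semi-algebraic refutation of size at most $q(n,2^w)$ (i.e. size polynomial in $n$ and $2^w$) and degree at most $C\cdot w+C$ (i.e. degree linear in $w$).
   Context: **Semi-algebraic proofs.** Let $\mathbf{x}=(x_1,\dots,x_n)$ be formal variables. Proofs manipulate inequalities $P(\mathbf{x})\ge 0$, where $P$ is a polynomial with rational coefficients. A proof from a set of hypotheses (polynomial inequalities) is a finite sequence of inequalities, each of which is a hypothesis, or an axiom, or follows from earlier ones in the sequence by an inference rule. - Axioms, for each variable $x_i$: $x_i\ge 0$, $\;1-x_i\ge 0$, $\;x_i^2-x_i\ge 0$, $\;x_i-x_i^2\ge 0$. - Positive linear combination: from $P\ge 0$ and $Q\ge 0$ infer $a\cdot P+b\cdot Q\ge 0$, for non-negative rationals $a,b$. - Multiplication (lifting) rules: from $P\ge 0$ infer $P\cdot x_i\ge 0$; from $P\ge 0$ infer $P\cdot(1-x_i)\ge 0$. Polynomials are identified when they are equal as formal polynomials. An inequality $P\ge Q$ means $P-Q\ge 0$. A refutation of a set of hypotheses is a proof of $-1\ge 0$ from it. Derived inequalities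 may be used several times as hypotheses of rules (a proof is called tree-like if every derived inequality is used at most once). **Measures.** The degree of a proof is the maximum total degree of the polynomials appearing in it. The size of a polynomial is the sum of the degrees of its monomials. The size of a proof is the sum of the sizes of the polynomials that appear in it. **Encoding of linear equations over $\mathbb{F}_2$.** Elements of $\mathbb{F}_2$ are identified with $\{0,1\}$, and $[n]=\{1,\dots,n\}$. For $\mathbf{a}\in\mathbb{F}_2^n$ and $b\in\mathbb{F}_2$, let $I=\mathrm{supp}(\mathbf{a})=\{i\in[n]:a_i\ne 0\}$. Then $\mathcal{S}(\mathbf{a},b)$ is the set of inequalities $$\sum_{i\in T}(1-x_i)+\sum_{i\in I\setminus T}x_i\ \ge\ 1\qquad\text{for all } T\subseteq I \text{ with } |T|\equiv 1-b \bmod 2.$$ For a system $\mathbf{A}\mathbf{x}=\mathbf{b}$ with rows $\mathbf{a}_1,\dots,\mathbf{a}_m$ of $\mathbf{A}$ and $\mathbf{b}=(b_1,\dots,b_m)$, let $\mathcal{S}(\mathbf{A},\mathbf{b})=\bigcup_{i=1}^m\mathcal{S}(\mathbf{a}_i,b_i)$. *)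

theory Defs
  imports
    "HOL-Library.Poly_Mapping"
    "HOL-Library.Z2"
    "HOL-Computational_Algebra.Polynomial"
    "Jordan_Normal_Form.Matrix"
begin

(* Polynomials in Q[x_0, x_1, ...]; variables are numbered from 0, in agreement with the column
   indices of the matrices, so that x_0, ..., x_(n-1) are the n variables of a proof. *)
type_synonym monomial = "nat \<Rightarrow>\<^sub>0 nat"
type_synonym mpol = "monomial \<Rightarrow>\<^sub>0 rat"

definition Var :: "nat \<Rightarrow> mpol" where
  "Var i = Poly_Mapping.single (Poly_Mapping.single i 1) 1"

definition Const :: "rat \<Rightarrow> mpol" where
  "Const c = Poly_Mapping.single 0 c"

definition mon_degree :: "monomial \<Rightarrow> nat" where
  "mon_degree u = (\<Sum>i\<in>Poly_Mapping.keys u. Poly_Mapping.lookup u i)"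

(* The zero polynomial gets degree 0. *)
definition total_degree :: "mpol \<Rightarrow> nat" where
  "total_degree P = Max (insert 0 (mon_degree ` Poly_Mapping.keys P))"

definition pol_size :: "mpol \<Rightarrow> nat" where
  "pol_size P = (\<Sum>u\<in>Poly_Mapping.keys P. mon_degree u)"

(* Throughout, a polynomial P stands for the inequality P >= 0. *)

definition sa_axioms :: "nat \<Rightarrow> mpol set" where
  "sa_axioms n = (\<Union>i<n. {Var i, 1 - Var i, Var i ^ 2 - Var i, Var i - Var i ^ 2})"

inductive infers :: "nat \<Rightarrow> mpol set \<Rightarrow> mpol \<Rightarrow> bool" for n :: nat and S :: "mpol set" where
  lin_comb: "\<lbrakk>P \<in> S; Q \<in> S; 0 \<le> a; 0 \<le> b\<rbrakk> \<Longrightarrow> infers n S (Const a * P + Const b * Q)"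
| mult_var: "\<lbrakk>P \<in> S; i < n\<rbrakk> \<Longrightarrow> infers n S (P * Var i)"
| mult_neg: "\<lbrakk>P \<in> S; i < n\<rbrakk> \<Longrightarrow> infers n S (P * (1 - Var i))"

definition sa_proof :: "nat \<Rightarrow> mpol set \<Rightarrow> mpol list \<Rightarrow> bool" where
  "sa_proof n H ps \<longleftrightarrow>
     (\<forall>k<length ps. ps ! k \<in> H \<or> ps ! k \<in> sa_axioms n \<or> infers n (set (take k ps)) (ps ! k))"

definition sa_refutation :: "nat \<Rightarrow> mpol set \<Rightarrow> mpol list \<Rightarrow> bool" where
  "sa_refutation n H ps \<longleftrightarrow> sa_proof n H ps \<and> ps \<noteq> [] \<and> last ps = - 1"

definition proof_degree :: "mpol list \<Rightarrow> nat" where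
  "proof_degree ps = Max (insert 0 (total_degree ` set ps))"

definition proof_size :: "mpol list \<Rightarrow> nat" where
  "proof_size ps = (\<Sum>P\<leftarrow>ps. pol_size P)"

definition supp :: "bit vec \<Rightarrow> nat set" where
  "supp a = {i. i < dim_vec a \<and> a $ i \<noteq> 0}"

(* The parity condition |T| = 1 - b (mod 2) is stated as an equation in the field bit. *)
definition enc_row :: "bit vec \<Rightarrow> bit \<Rightarrow> mpol set" where
  "enc_row a b =
     {((\<Sum>i\<in>T. 1 - Var i) + (\<Sum>i\<in>supp a - T. Var i)) - 1 | T. T \<subseteq> supp a \<and> of_nat (card T) = 1 - b}"

definition enc_system :: "bit mat \<Rightarrow> bit vec \<Rightarrow> mpol set" where
  "enc_system A b = (\<Union>i<dim_row A. enc_row (row A i) (b $ i))"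

definition max_row_weight :: "bit mat \<Rightarrow> nat" where
  "max_row_weight A = Max ((\<lambda>i. card (supp (row A i))) ` {..<dim_row A})"

definition eval2 :: "real poly poly \<Rightarrow> real \<Rightarrow> real \<Rightarrow> real" where
  "eval2 q x y = poly (poly q [:y:]) x"

end

theory Submission
  imports Defs
begin

text \<open>
  Choose a minimal set \<open>I\<close> of rows whose sum is the equation \<open>0 = 1\<close>; it has at most \<open>n + 1\<close> elements.
  Over the integers, let \<open>D\<^sub>J\<close> be the sum of the linear forms \<open>\<Sum>j\<in>V i. x\<^sub>j\<close> with \<open>i \<in> J\<close>, where \<open>V i\<close> is
  the support of row \<open>i\<close>. That \<open>D\<^sub>J\<close> has the parity demanded by the rows in \<open>J\<close> is expressed by the
  quadratic inequalities \<open>(D\<^sub>J - c)\<^sup>2 - 1 \<ge> 0\<close>, one for every small integer \<open>c\<close> of the wrong parity.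
  A row \<open>i\<close> is added to \<open>J\<close> by multiplying with the indicator polynomials of the
  assignments \<open>T\<close> to \<open>V i\<close>, which sum up to \<open>1\<close>: if \<open>T\<close> satisfies the row, the new inequality for \<open>c\<close>
  is the old one for \<open>c - |T|\<close>; otherwise a clause makes the indicator vanish.
  All coefficients of \<open>D\<^sub>I\<close> are even, while its parity is claimed to be odd. So the variables can be
  removed from \<open>D\<^sub>I\<close> one at a time, again by a case distinction: for both values of \<open>x\<close>, the
  inequality for \<open>W\<close> and \<open>c\<close> is the one for \<open>W + d x\<close> and \<open>c\<close> or \<open>c + d\<close>. What remains in the end is
  \<open>0\<^sup>2 - 1 \<ge> 0\<close>.
\<close>

subsection \<open>Monomials\<close>

text \<open>
  A multilinear monomial in the variables from \<open>V\<close> times at most \<open>r\<close> arbitrary variables. Keeping all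
  lines of a derivation in the span of such a set bounds both their degrees and their sizes.
\<close>
primrec mons :: "nat \<Rightarrow> nat set \<Rightarrow> nat \<Rightarrow> monomial set" where
  "mons n V 0 = (\<lambda>U. \<Sum>j\<in>U. Poly_Mapping.single j 1) ` Pow V"
| "mons n V (Suc r) = mons n V r \<union> (\<Union>i<n. (\<lambda>u. u + Poly_Mapping.single i 1) ` mons n V r)"

section \<open>Supports of sums, differences and multiples\<close>

lemma keys_minus_subset:
  "Poly_Mapping.keys (P - Q) \<subseteq> Poly_Mapping.keys P \<union> Poly_Mapping.keys (Q :: 'a \<Rightarrow>\<^sub>0 'b::ab_group_add)"
  by (auto simp: in_keys_iff lookup_minus)

lemma keys_sum_subset:
  fixes f :: "'c \<Rightarrow> 'a \<Rightarrow>\<^sub>0 'b::comm_monoid_add"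
  assumes "\<And>i. i \<in> I \<Longrightarrow> Poly_Mapping.keys (f i) \<subseteq> M"
  shows "Poly_Mapping.keys (sum f I) \<subseteq> M"
  using assms
proof (induction I rule: infinite_finite_induct)
  case (insert i I)
  then show ?case
    using Poly_Mapping.keys_add[of "f i" "sum f I"] by auto
qed auto

lemma poly_mapping_eq_sum_single:
  fixes P :: "'a \<Rightarrow>\<^sub>0 'b::comm_monoid_add"
  shows "P = (\<Sum>u\<in>Poly_Mapping.keys P. Poly_Mapping.single u (Poly_Mapping.lookup P u))"
proof (rule poly_mapping_eqI)
  fix v
  show "Poly_Mapping.lookup P v = Poly_Mapping.lookup
     (\<Sum>u\<in>Poly_Mapping.keys P. Poly_Mapping.single u (Poly_Mapping.lookup P u)) v"
    by (simp add: lookup_sum lookup_single when_def sum.delta' in_keys_iff cong: if_cong)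
qed

lemma Const_simps [simp]: "Const 0 = 0" "Const 1 = 1" "Const (-1) = -1"
  by (simp_all add: Const_def single_uminus)

lemma Const_of_int: "Const (of_int k) = of_int k"
  by (simp add: Const_def)

lemma keys_Const_mult: "Poly_Mapping.keys (Const a * P) \<subseteq> Poly_Mapping.keys P"
  using keys_mult[of "Const a" P] by (auto simp: Const_def split: if_splits)

lemma keys_Var [simp]: "Poly_Mapping.keys (Var i) = {Poly_Mapping.single i 1}"
  by (simp add: Var_def)

lemma finite_mons: "finite V \<Longrightarrow> finite (mons n V r)"
  by (induction r) auto

text \<open>Each of the \<open>r\<close> free factors is absent or one of \<open>n\<close>
  variables, and the multilinear part is given by a subset of \<open>V\<close>.\<close>

lemma card_mons: "finite V \<Longrightarrow> card (mons n V r) \<le> (n + 1) ^ r * 2 ^ card V"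
proof (induction r)
  case 0
  then show ?case using card_image_le[of "Pow V"] by (simp add: card_Pow)
next
  case (Suc r)
  let ?g = "\<lambda>i. (\<lambda>u. u + Poly_Mapping.single i 1) ` mons n V r"
  have "card (\<Union>i<n. ?g i) \<le> (\<Sum>i<n. card (?g i))"
    by (rule card_UN_le) simp
  also have "\<dots> \<le> (\<Sum>i<n. card (mons n V r))"
    by (intro sum_mono card_image_le finite_mons Suc.prems)
  finally have "card (\<Union>i<n. ?g i) \<le> n * card (mons n V r)" by simp
  then have "card (mons n V (Suc r)) \<le> card (mons n V r) + n * card (mons n V r)"
    using card_Un_le[of "mons n V r" "\<Union>i<n. ?g i"] unfolding mons.simps by linarith
  also have "\<dots> = (n + 1) * card (mons n V r)" by simp
  also have "\<dots> \<le> (n + 1) * ((n + 1) ^ r * 2 ^ card V)"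
    using Suc by (intro mult_le_mono) auto
  finally show ?case by (simp add: algebra_simps)
qed

lemma mon_degree_add: "mon_degree (u + v) = mon_degree u + mon_degree v"
  unfolding mon_degree_def
  by (rule setsum_keys_plus_distrib[of "\<lambda>_ k. k"]) auto

lemma mon_degree_single [simp]: "mon_degree (Poly_Mapping.single i k) = k"
  by (simp add: mon_degree_def)

lemma mon_degree_sum: "mon_degree (sum f I) = (\<Sum>i\<in>I. mon_degree (f i))"
  by (induction I rule: infinite_finite_induct) (auto simp: mon_degree_add, auto simp: mon_degree_def)

lemma mon_degree_mons: "finite V \<Longrightarrow> u \<in> mons n V r \<Longrightarrow> mon_degree u \<le> card V + r"
proof (induction r arbitrary: u)
  case 0
  then show ?case by (auto simp: mon_degree_sum card_mono)
next
  case (Suc r)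
  then show ?case by (fastforce simp: mon_degree_add)
qed

lemma mons_mono: "V \<subseteq> W \<Longrightarrow> r \<le> s \<Longrightarrow> mons n V r \<subseteq> mons n W s"
proof -
  assume V: "V \<subseteq> W" and r: "r \<le> s"
  have "mons n V r \<subseteq> mons n W r"
    using V by (induction r) (auto 4 4)
  moreover have "mons n W r \<subseteq> mons n W s"
    using r by (induction s rule: dec_induct) auto
  ultimately show ?thesis by blast
qed

lemma zero_in_mons [simp]: "0 \<in> mons n V r"
  using mons_mono[of V V 0 r n] by force

lemma single_in_mons: "i < n \<Longrightarrow> 1 \<le> r \<Longrightarrow> Poly_Mapping.single i 1 \<in> mons n V r"
  using mons_mono[of V V 1 r n] by force

lemma mons_add_single: "u \<in> mons n V r \<Longrightarrow> i < n \<Longrightarrow> u + Poly_Mapping.single i 1 \<in> mons n V (Suc r)"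
  by auto

text \<open>A variable outside \<open>V\<close> joins the multilinear part, so \<open>r\<close>
  stays the same. Literals of an indicator thus cost a factor 2 each in the number of monomials, not
  a factor \<open>n + 1\<close>.\<close>

lemma mons_add_single_insert:
  assumes "finite V" "j \<notin> V"
  shows "u \<in> mons n V r \<Longrightarrow> u + Poly_Mapping.single j 1 \<in> mons n (insert j V) r"
proof (induction r arbitrary: u)
  case 0
  then obtain U where U: "U \<subseteq> V" "u = (\<Sum>j\<in>U. Poly_Mapping.single j 1)" by auto
  with assms have "u + Poly_Mapping.single j 1 = (\<Sum>j\<in>insert j U. Poly_Mapping.single j 1)"
    by (subst sum.insert) (auto intro: finite_subset simp: add.commute)
  with U show ?case by (auto intro!: image_eqI)
next
  case (Suc r)
  from Suc.prems consider "u \<in> mons n V r"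
    | v i where "v \<in> mons n V r" "i < n" "u = v + Poly_Mapping.single i 1"
    by auto
  then show ?case
  proof cases
    case 1
    then show ?thesis using Suc.IH by simp
  next
    case 2
    have "u + Poly_Mapping.single j 1 = (v + Poly_Mapping.single j 1) + Poly_Mapping.single i 1"
      using 2 by (simp only: ac_simps)
    then show ?thesis using mons_add_single[OF Suc.IH[OF 2(1)] 2(2)] by metis
  qed
qed

lemma keys_mult_Var:
  "Poly_Mapping.keys (P * Var i) \<subseteq> (\<lambda>u. u + Poly_Mapping.single i 1) ` Poly_Mapping.keys P"
  using keys_mult[of P "Var i"] by auto

lemma keys_mult_Var_mons:
  assumes "Poly_Mapping.keys P \<subseteq> mons n V r" "i < n"
  shows "Poly_Mapping.keys (P * Var i) \<subseteq> mons n V (Suc r)"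
  using keys_mult_Var[of P i] mons_add_single[of _ n V r i] assms by blast

text \<open>A set \<open>T\<close> encodes the assignment that gives exactly its members the value
  1. On 0/1 points the literal is 1 iff \<open>x_j\<close> has its value under
  \<open>T\<close>.\<close>

definition literal :: "nat set \<Rightarrow> nat \<Rightarrow> mpol" where
  "literal T j = (if j \<in> T then Var j else 1 - Var j)"

lemma keys_mult_literal_insert:
  assumes "Poly_Mapping.keys P \<subseteq> mons n V r" "finite V" "j \<notin> V"
  shows "Poly_Mapping.keys (P * literal T j) \<subseteq> mons n (insert j V) r"
proof -
  have 1: "Poly_Mapping.keys (P * Var j) \<subseteq> mons n (insert j V) r"
    using keys_mult_Var[of P j] mons_add_single_insert[of V j _ n r] assms by blast
  have "P * (1 - Var j) = P - P * Var j" by (simp add: algebra_simps)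
  then have "Poly_Mapping.keys (P * (1 - Var j)) \<subseteq> mons n (insert j V) r"
    using 1 keys_minus_subset[of P "P * Var j"] assms(1) mons_mono[of V "insert j V" r r n] by force
  with 1 show ?thesis by (simp add: literal_def)
qed

subsection \<open>Derivations with few lines\<close>

text \<open>Number of lines and a common support are easy to track through the rules; together they
  bound size and degree.\<close>

definition derivable :: "nat \<Rightarrow> mpol set \<Rightarrow> monomial set \<Rightarrow> nat \<Rightarrow> mpol \<Rightarrow> bool" where
  "derivable n X M N P \<longleftrightarrow> (\<exists>ps. sa_proof n X ps \<and> P \<in> set ps \<and> length ps \<le> N \<and>
     (\<forall>Q\<in>set ps. Poly_Mapping.keys Q \<subseteq> M))"

text \<open>The equation \<open>P = 0\<close> as two inequalities. Unlike an inequality, an equation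
  may be multiplied by polynomials of any sign.\<close>

definition vanishing :: "nat \<Rightarrow> mpol set \<Rightarrow> monomial set \<Rightarrow> nat \<Rightarrow> mpol \<Rightarrow> bool" where
  "vanishing n X M N P \<longleftrightarrow> derivable n X M N P \<and> derivable n X M N (- P)"

definition indicator_pol :: "nat set \<Rightarrow> nat set \<Rightarrow> mpol" where
  "indicator_pol V T = (\<Prod>j\<in>V. literal T j)"

lemma sa_proof_Nil [simp]: "sa_proof n X []"
  by (simp add: sa_proof_def)

lemma sa_proof_snoc:
  "sa_proof n X (ps @ [P]) \<longleftrightarrow>
     sa_proof n X ps \<and> (P \<in> X \<or> P \<in> sa_axioms n \<or> infers n (set ps) P)"
  unfolding sa_proof_def by (auto simp: nth_append less_Suc_eq)

lemma infers_mono: "infers n S P \<Longrightarrow> S \<subseteq> S' \<Longrightarrow> infers n S' P"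
  by (induction rule: infers.induct) (auto intro: infers.intros)

lemma sa_proof_mono: "sa_proof n X ps \<Longrightarrow> X \<subseteq> Y \<Longrightarrow> sa_proof n Y ps"
  unfolding sa_proof_def by blast

lemma sa_proof_repeat:
  assumes "sa_proof n X ps" "P \<in> set ps"
  shows "sa_proof n X (ps @ [P])"
proof -
  have "infers n (set ps) (Const 1 * P + Const 0 * P)"
    using assms by (intro infers.lin_comb) auto
  with assms show ?thesis by (simp add: sa_proof_snoc)
qed

text \<open>A line of \<open>qs\<close> that quotes a line of \<open>ps\<close> as a hypothesis
  turns into the combination \<open>1 * P + 0 * P\<close> of that line, so no lines have to be
  inserted.\<close>

lemma sa_proof_append:
  assumes "sa_proof n X ps" "sa_proof n (X \<union> set ps) qs"
  shows "sa_proof n X (ps @ qs)"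
  using assms(2)
proof (induction qs rule: rev_induct)
  case Nil
  then show ?case using assms(1) by simp
next
  case (snoc Q qs)
  have "sa_proof n X (ps @ qs)" "Q \<in> X \<or> Q \<in> set ps \<or> Q \<in> sa_axioms n \<or> infers n (set qs) Q"
    using snoc by (auto simp: sa_proof_snoc)
  then show ?case
    using sa_proof_repeat[of n X "ps @ qs" Q] infers_mono[of n "set qs" Q "set (ps @ qs)"]
    by (auto simp: sa_proof_snoc simp flip: append_assoc)
qed

lemma derivable_mono:
  "derivable n X M N P \<Longrightarrow> M \<subseteq> M' \<Longrightarrow> N \<le> N' \<Longrightarrow> derivable n X M' N' P"
  unfolding derivable_def by (meson order_trans)

lemma derivable_hyp:
  "P \<in> X \<or> P \<in> sa_axioms n \<Longrightarrow> Poly_Mapping.keys P \<subseteq> M \<Longrightarrow> derivable n X M 1 P"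
  unfolding derivable_def by (rule exI[of _ "[P]"]) (auto simp: sa_proof_def)

lemma derivable_keys: "derivable n X M N P \<Longrightarrow> Poly_Mapping.keys P \<subseteq> M"
  unfolding derivable_def by blast

lemma derivable_snoc:
  assumes "sa_proof n X ps" "infers n (set ps) P" "length ps \<le> N"
    "\<forall>Q\<in>set ps. Poly_Mapping.keys Q \<subseteq> M" "Poly_Mapping.keys P \<subseteq> M"
  shows "derivable n X M (Suc N) P"
  unfolding derivable_def
  by (rule exI[of _ "ps @ [P]"]) (use assms in \<open>auto simp: sa_proof_snoc\<close>)

lemma derivable_lin_comb:
  assumes "derivable n X M N1 P" "derivable n X M N2 Q" "0 \<le> a" "0 \<le> b"
  shows "derivable n X M (Suc (N1 + N2)) (Const a * P + Const b * Q)"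
proof -
  obtain ps qs where ps: "sa_proof n X ps" "P \<in> set ps" "length ps \<le> N1"
      "\<forall>Q\<in>set ps. Poly_Mapping.keys Q \<subseteq> M"
    and qs: "sa_proof n X qs" "Q \<in> set qs" "length qs \<le> N2"
      "\<forall>Q\<in>set qs. Poly_Mapping.keys Q \<subseteq> M"
    using assms(1,2) unfolding derivable_def by blast
  show ?thesis
  proof (rule derivable_snoc[where ps = "ps @ qs"])
    show "sa_proof n X (ps @ qs)"
      using ps(1) qs(1) by (blast intro: sa_proof_append sa_proof_mono)
    show "infers n (set (ps @ qs)) (Const a * P + Const b * Q)"
      using ps(2) qs(2) assms by (intro infers.lin_comb) auto
    show "Poly_Mapping.keys (Const a * P + Const b * Q) \<subseteq> M"
      using Poly_Mapping.keys_add[of "Const a * P" "Const b * Q"]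
        keys_Const_mult[of a P] keys_Const_mult[of b Q] ps qs by blast
  qed (use ps qs in auto)
qed

lemma derivable_add:
  assumes "derivable n X M N1 P" "derivable n X M N2 Q"
  shows "derivable n X M (Suc (N1 + N2)) (P + Q)"
  using derivable_lin_comb[OF assms, of 1 1] by simp

text \<open>Pairing \<open>P\<close> with itself inside one proof adds a single line, whereas
  \<open>derivable_lin_comb\<close> would count the derivation twice.\<close>

lemma derivable_scale:
  assumes "derivable n X M N P" "0 \<le> a"
  shows "derivable n X M (Suc N) (Const a * P)"
proof -
  obtain ps where ps: "sa_proof n X ps" "P \<in> set ps" "length ps \<le> N"
      "\<forall>Q\<in>set ps. Poly_Mapping.keys Q \<subseteq> M"
    using assms(1) unfolding derivable_def by blast
  have "infers n (set ps) (Const a * P + Const 0 * P)"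
    using ps assms by (intro infers.lin_comb) auto
  then show ?thesis
    using ps keys_Const_mult[of a P] by (intro derivable_snoc[where ps = ps]) auto
qed

lemma derivable_mult_literal:
  assumes "derivable n X M N P" "j < n" "Poly_Mapping.keys (P * literal T j) \<subseteq> M'" "M \<subseteq> M'"
  shows "derivable n X M' (Suc N) (P * literal T j)"
proof -
  obtain ps where ps: "sa_proof n X ps" "P \<in> set ps" "length ps \<le> N"
      "\<forall>Q\<in>set ps. Poly_Mapping.keys Q \<subseteq> M"
    using assms(1) unfolding derivable_def by blast
  have "infers n (set ps) (P * literal T j)"
    using ps assms(2) by (auto simp: literal_def intro: infers.intros)
  then show ?thesis
    using ps assms by (intro derivable_snoc[where ps = ps]) blast+
qed

lemma derivable_mult_Var:
  assumes "derivable n X (mons n V r) N P" "i < n"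
  shows "derivable n X (mons n V (Suc r)) (Suc N) (P * Var i)"
  \<comment> \<open>With \<open>T = UNIV\<close> the literal is the variable itself.\<close>
  using derivable_mult_literal[of n X "mons n V r" N P i UNIV "mons n V (Suc r)"] assms
    keys_mult_Var_mons[OF derivable_keys[OF assms(1)] assms(2)]
  by (simp add: literal_def)

text \<open>One line per literal. Since the multilinear part is empty at the start, every literal
  brings a new variable to it and \<open>r\<close> is preserved.\<close>

lemma derivable_mult_indicator:
  assumes "derivable n X (mons n {} r) N P" "finite V" "V \<subseteq> {..<n}"
  shows "derivable n X (mons n V r) (N + card V) (P * indicator_pol V T)"
  using assms(2,3)
proof (induction V rule: finite_induct)
  case empty
  then show ?case using assms(1) by (simp add: indicator_pol_def)
next
  case (insert j V)
  then have "derivable n X (mons n V r) (N + card V) (P * indicator_pol V T)" by simp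
  then have "derivable n X (mons n (insert j V) r) (Suc (N + card V)) (P * indicator_pol V T * literal T j)"
    using insert by (intro derivable_mult_literal[of n X "mons n V r"] keys_mult_literal_insert mons_mono subset_insertI)
      (auto dest: derivable_keys)
  then show ?case
    using insert by (simp add: indicator_pol_def mult_ac)
qed

lemma sa_axiomsI:
  "i < n \<Longrightarrow> Var i \<in> sa_axioms n"
  "i < n \<Longrightarrow> 1 - Var i \<in> sa_axioms n"
  "i < n \<Longrightarrow> Var i ^ 2 - Var i \<in> sa_axioms n"
  "i < n \<Longrightarrow> Var i - Var i ^ 2 \<in> sa_axioms n"
  by (auto simp: sa_axioms_def)

text \<open>The zero polynomial is \<open>0 * x_0\<close>, obtained from an axiom; this takes at
  least one variable.\<close>

lemma derivable_zero:
  assumes "1 \<le> n" "1 \<le> r"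
  shows "derivable n X (mons n V r) 2 0"
proof -
  have "derivable n X (mons n V r) 1 (Var 0)"
    using assms single_in_mons[of 0 n r V]
    by (intro derivable_hyp) (auto intro: sa_axiomsI)
  from derivable_scale[OF this, of 0] show ?thesis by (simp add: numeral_2_eq_2)
qed

text \<open>The axioms \<open>x_0\<close> and \<open>1 - x_0\<close> add up to 1.\<close>

lemma derivable_one:
  assumes "1 \<le> n" "1 \<le> r"
  shows "derivable n X (mons n V r) 3 1"
proof -
  have k: "Poly_Mapping.keys (Var 0) \<subseteq> mons n V r"
    using assms single_in_mons[of 0 n r V] by simp
  then have "Poly_Mapping.keys (1 - Var 0) \<subseteq> mons n V r"
    using keys_minus_subset[of 1 "Var 0"] by auto
  with k have "derivable n X (mons n V r) 1 (Var 0)" "derivable n X (mons n V r) 1 (1 - Var 0)"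
    using assms by (intro derivable_hyp disjI2 sa_axiomsI; simp)+
  from derivable_add[OF this] show ?thesis by (simp add: numeral_3_eq_3)
qed

lemma derivable_sum:
  assumes "1 \<le> n" "1 \<le> r" "finite I" "\<And>i. i \<in> I \<Longrightarrow> derivable n X (mons n V r) N (f i)"
  shows "derivable n X (mons n V r) (card I * (N + 1) + 2) (sum f I)"
  using assms(3,4)
proof (induction I rule: finite_induct)
  case empty
  then show ?case using derivable_zero[OF assms(1,2)] by (simp add: numeral_2_eq_2)
next
  case (insert i I)
  have "derivable n X (mons n V r) (Suc (N + (card I * (N + 1) + 2))) (f i + sum f I)"
    using insert by (intro derivable_add) auto
  then show ?case using insert by (simp add: algebra_simps)
qed

section \<open>Calculus of derived equations\<close>

lemma vanishing_mono:
  "vanishing n X M N P \<Longrightarrow> M \<subseteq> M' \<Longrightarrow> N \<le> N' \<Longrightarrow> vanishing n X M' N' P"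
  unfolding vanishing_def using derivable_mono by blast

lemma vanishing_scale:
  assumes "vanishing n X M N P"
  shows "vanishing n X M (Suc N) (Const a * P)"
proof (cases "0 \<le> a")
  case True
  then show ?thesis
    using assms derivable_scale[of n X M N P a] derivable_scale[of n X M N "- P" a]
    by (simp add: vanishing_def)
next
  case False
  \<comment> \<open>A negative factor exchanges the two inequalities.\<close>
  have "Const a = - Const (- a)" by (simp add: Const_def single_uminus)
  with False show ?thesis
    using assms derivable_scale[of n X M N P "- a"] derivable_scale[of n X M N "- P" "- a"]
    by (simp add: vanishing_def)
qed

lemma vanishing_sum:
  assumes "1 \<le> n" "1 \<le> r" "finite I" "\<And>i. i \<in> I \<Longrightarrow> vanishing n X (mons n V r) N (f i)"
  shows "vanishing n X (mons n V r) (card I * (N + 1) + 2) (sum f I)"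
  using assms derivable_sum[of n r I X V N f] derivable_sum[of n r I X V N "\<lambda>i. - f i"]
  by (simp add: vanishing_def sum_negf)

lemma vanishing_mult_Var:
  assumes "vanishing n X (mons n V r) N P" "i < n"
  shows "vanishing n X (mons n V (Suc r)) (Suc N) (P * Var i)"
  using assms derivable_mult_Var[of n X V r N P i] derivable_mult_Var[of n X V r N "- P" i]
  by (simp add: vanishing_def)

text \<open>The set \<open>mons n {} 1\<close> consists of the constant monomial and the
  \<open>n\<close> variables.\<close>

definition affine_pol :: "nat \<Rightarrow> mpol \<Rightarrow> bool" where
  "affine_pol n L \<longleftrightarrow> Poly_Mapping.keys L \<subseteq> mons n {} 1"

text \<open>The product is assembled from the at most \<open>n + 1\<close> terms of
  \<open>L\<close>, each costing at most one multiplication and one scaling per inequality.\<close>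

lemma vanishing_mult_affine:
  assumes "vanishing n X (mons n V r) N P" "1 \<le> n" "affine_pol n L" "n + 1 \<le> B"
  shows "vanishing n X (mons n V (Suc r)) (B * (N + 3) + 2) (P * L)"
proof -
  note L = assms(3)[unfolded affine_pol_def]
  let ?K = "Poly_Mapping.keys L"
  have c: "card ?K \<le> B"
    using card_mono[OF finite_mons L] card_mons[of "{}" n 1] assms(4) by simp
  have *: "vanishing n X (mons n V (Suc r)) (N + 2) (P * Poly_Mapping.single u (Poly_Mapping.lookup L u))"
    if "u \<in> ?K" for u
  proof -
    have "u = 0 \<or> (\<exists>i<n. u = Poly_Mapping.single i 1)"
      using that L by auto
    then have "vanishing n X (mons n V (Suc r)) (Suc N) (P * Poly_Mapping.single u 1)"
      using vanishing_mult_Var[OF assms(1)] vanishing_mono[OF assms(1), of "mons n V (Suc r)" "Suc N"]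
      by (auto simp: Var_def)
    from vanishing_scale[OF this, of "Poly_Mapping.lookup L u"] show ?thesis
      by (simp add: Const_def mult_single mult.left_commute[of "Poly_Mapping.single 0 _"])
  qed
  have "vanishing n X (mons n V (Suc r)) (card ?K * (N + 2 + 1) + 2)
      (\<Sum>u\<in>?K. P * Poly_Mapping.single u (Poly_Mapping.lookup L u))"
    using * assms by (intro vanishing_sum) auto
  also have "(\<Sum>u\<in>?K. P * Poly_Mapping.single u (Poly_Mapping.lookup L u)) = P * L"
    by (subst (2) poly_mapping_eq_sum_single[of L]) (rule sum_distrib_left[symmetric])
  finally show ?thesis
    by (rule vanishing_mono) (use mult_le_mono1[OF c, of "N + 3"] in \<open>simp_all add: algebra_simps\<close>)
qed

subsection \<open>Case distinctions\<close>

lemma keys_mult_affine: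
  assumes "Poly_Mapping.keys P \<subseteq> mons n V r" "affine_pol n L"
  shows "Poly_Mapping.keys (P * L) \<subseteq> mons n V (Suc r)"
proof
  fix u assume "u \<in> Poly_Mapping.keys (P * L)"
  then obtain a b where ab: "u = a + b" "a \<in> Poly_Mapping.keys P" "b \<in> Poly_Mapping.keys L"
    using keys_mult[of P L] by blast
  then have "b \<in> mons n {} 1" using assms(2) unfolding affine_pol_def by blast
  then have "b = 0 \<or> (\<exists>i<n. b = Poly_Mapping.single i 1)" by auto
  then show "u \<in> mons n V (Suc r)"
  proof
    assume "b = 0"
    then have "u = a" using ab(1) by simp
    moreover have "mons n V r \<subseteq> mons n V (Suc r)" by (rule mons_mono) auto
    ultimately show ?thesis using ab(2) assms(1) by blast
  next
    assume "\<exists>i<n. b = Poly_Mapping.single i 1"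
    then show ?thesis using ab assms(1) mons_add_single[of a n V r] by blast
  qed
qed

lemma affine_pol_of_int: "affine_pol n (of_int c)"
proof -
  have "of_int c = Poly_Mapping.single (0 :: monomial) (of_int c :: rat)" by simp
  then have "Poly_Mapping.keys (of_int c :: mpol) \<subseteq> {0}"
    by (metis empty_subsetI keys_single order_refl)
  then show ?thesis
    unfolding affine_pol_def using zero_in_mons[of n "{}" 1] by blast
qed

lemma affine_pol_Var: "i < n \<Longrightarrow> affine_pol n (Var i)"
  unfolding affine_pol_def using single_in_mons[of i n 1 "{}"] by simp

lemma affine_pol_add: "affine_pol n L \<Longrightarrow> affine_pol n L' \<Longrightarrow> affine_pol n (L + L')"
  unfolding affine_pol_def using Poly_Mapping.keys_add[of L L'] by blast

lemma affine_pol_diff: "affine_pol n L \<Longrightarrow> affine_pol n L' \<Longrightarrow> affine_pol n (L - L')"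
  unfolding affine_pol_def using keys_minus_subset[of L L'] by blast

lemma affine_pol_Const_mult: "affine_pol n L \<Longrightarrow> affine_pol n (Const a * L)"
  unfolding affine_pol_def using keys_Const_mult[of a L] by blast

lemma affine_pol_sum: "(\<And>i. i \<in> I \<Longrightarrow> affine_pol n (f i)) \<Longrightarrow> affine_pol n (sum f I)"
  unfolding affine_pol_def by (rule keys_sum_subset)

lemma keys_affine_square: "affine_pol n L \<Longrightarrow> Poly_Mapping.keys (L ^ 2) \<subseteq> mons n {} 2"
  using keys_mult_affine[of L n "{}" 1 L] by (simp add: affine_pol_def power2_eq_square numeral_2_eq_2)

text \<open>A linear form that vanishes under the assignment \<open>T\<close>, hence modulo \<open>x\<^sub>j\<^sup>2 - x\<^sub>j\<close> after
  multiplication with the indicator of \<open>T\<close>.\<close>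
definition deviation :: "nat set \<Rightarrow> nat set \<Rightarrow> (nat \<Rightarrow> rat) \<Rightarrow> mpol" where
  "deviation V T k = (\<Sum>j\<in>V. Const (k j) * (Var j - of_bool (j \<in> T)))"

lemma affine_pol_deviation:
  assumes "V \<subseteq> {..<n}"
  shows "affine_pol n (deviation V T k)"
proof -
  have "affine_pol n (Var j - of_bool (j \<in> T))" if "j \<in> V" for j
    using affine_pol_diff[OF affine_pol_Var affine_pol_of_int[where c = "of_bool (j \<in> T)"]] that assms by auto
  then show ?thesis
    unfolding deviation_def by (intro affine_pol_sum affine_pol_Const_mult)
qed

text \<open>Multiplying out the product of all \<open>x_j + (1 - x_j)\<close> gives one summand per
  assignment. This is an identity of formal polynomials.\<close>

lemma sum_indicator_pol:
  assumes "finite V"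
  shows "(\<Sum>T\<in>Pow V. indicator_pol V T) = 1"
proof -
  have "indicator_pol V T = (\<Prod>j\<in>T. Var j) * (\<Prod>j\<in>V - T. 1 - Var j)" if "T \<subseteq> V" for T
  proof -
    have "indicator_pol V T = (\<Prod>j\<in>T. literal T j) * (\<Prod>j\<in>V - T. literal T j)"
      unfolding indicator_pol_def using prod.subset_diff[OF that assms, of "literal T"] by (simp add: mult.commute)
    then show ?thesis by (simp add: literal_def)
  qed
  then have "(\<Sum>T\<in>Pow V. indicator_pol V T) = (\<Prod>j\<in>V. Var j + (1 - Var j))"
    unfolding prod_add[OF assms] by (intro sum.cong) auto
  then show ?thesis by simp
qed

text \<open>The literal of \<open>j\<close> times \<open>x_j\<close> minus its value under
  \<open>T\<close> is \<open>x_j ^ 2 - x_j\<close> or its negative, both axioms; the remaining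
  literals are then multiplied on.\<close>

lemma vanishing_indicator_mult:
  assumes "V \<subseteq> {..<n}" "j \<in> V"
  shows "vanishing n X (mons n V 2) (card V) (indicator_pol V T * (Var j - of_bool (j \<in> T)))"
proof -
  have fin: "finite V" using assms finite_subset by blast
  have j: "j < n" using assms by auto
  have "Poly_Mapping.keys (Var j ^ 2) \<subseteq> mons n {} 2"
    by (rule keys_affine_square[OF affine_pol_Var[OF j]])
  moreover have "Poly_Mapping.keys (Var j) \<subseteq> mons n {} 2"
    using single_in_mons[OF j, of 2 "{}"] by simp
  ultimately have k: "Poly_Mapping.keys (Var j ^ 2 - Var j) \<subseteq> mons n {} 2"
      "Poly_Mapping.keys (Var j - Var j ^ 2) \<subseteq> mons n {} 2"
    using keys_minus_subset[of "Var j ^ 2" "Var j"] keys_minus_subset[of "Var j" "Var j ^ 2"] by blast+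
  have d: "derivable n X (mons n {} 2) 1 (Var j ^ 2 - Var j)"
      "derivable n X (mons n {} 2) 1 (Var j - Var j ^ 2)"
    using k sa_axiomsI[OF j] by (blast intro: derivable_hyp)+
  have *: "derivable n X (mons n V 2) (card V) (P * indicator_pol (V - {j}) T)"
    if "derivable n X (mons n {} 2) 1 P" for P
  proof -
    have V': "finite (V - {j})" "V - {j} \<subseteq> {..<n}" using assms fin by auto
    have "mons n (V - {j}) 2 \<subseteq> mons n V 2" by (rule mons_mono) auto
    moreover have "1 + card (V - {j}) \<le> card V"
      using card.remove[OF fin assms(2)] by simp
    ultimately show ?thesis
      using derivable_mult_indicator[OF that V', of T] derivable_mono by blast
  qed
  have "indicator_pol V T = literal T j * indicator_pol (V - {j}) T"
    unfolding indicator_pol_def using assms fin by (simp add: prod.remove)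
  then have "indicator_pol V T * (Var j - of_bool (j \<in> T)) =
      (if j \<in> T then Var j ^ 2 - Var j else Var j - Var j ^ 2) * indicator_pol (V - {j}) T"
    by (simp add: literal_def algebra_simps power2_eq_square)
  then show ?thesis
    using *[OF d(1)] *[OF d(2)] by (auto simp: vanishing_def algebra_simps)
qed

text \<open>By linearity from the single variables; the affine factor raises the exponent from 2 to
  3.\<close>

lemma vanishing_indicator_mult_deviation:
  assumes "1 \<le> n" "V \<subseteq> {..<n}" "affine_pol n L" "n + 1 \<le> B" "card V + 1 \<le> B"
  shows "vanishing n X (mons n V 3) (10 * B ^ 3) (indicator_pol V T * deviation V T k * L)"
proof -
  have fin: "finite V" using assms finite_subset by blast
  let ?f = "\<lambda>j. indicator_pol V T * (Var j - of_bool (j \<in> T)) * (Const (k j) * L)"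
  have "vanishing n X (mons n V 3) (B * (card V + 3) + 2) (?f j)" if "j \<in> V" for j
    using vanishing_mult_affine[OF vanishing_indicator_mult[OF assms(2) that] assms(1) affine_pol_Const_mult[OF assms(3)] assms(4)]
    by (simp add: numeral_3_eq_3 numeral_2_eq_2)
  then have "vanishing n X (mons n V 3) (card V * (B * (card V + 3) + 2 + 1) + 2) (\<Sum>j\<in>V. ?f j)"
    using assms fin by (intro vanishing_sum) auto
  moreover have "(\<Sum>j\<in>V. ?f j) = indicator_pol V T * deviation V T k * L"
    by (simp add: deviation_def sum_distrib_left sum_distrib_right mult_ac)
  moreover have "card V * (B * (card V + 3) + 2 + 1) + 2 \<le> 10 * B ^ 3"
  proof -
    have B: "1 \<le> B" using assms by simp
    have "B * (card V + 3) \<le> B * (3 * B)"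
      using assms B by (intro mult_le_mono) auto
    then have "card V * (B * (card V + 3) + 2 + 1) \<le> B * (B * (3 * B) + 3)"
      using assms by (intro mult_le_mono) auto
    also have "\<dots> = 3 * B ^ 3 + 3 * B" by (simp add: algebra_simps power3_eq_cube)
    finally show ?thesis using B power_increasing[of 1 3 B] power_increasing[of 0 3 B] by simp
  qed
  ultimately show ?thesis by (auto intro: vanishing_mono)
qed

text \<open>As the indicators add up to 1, it suffices to derive each of their products with
  \<open>L ^ 2 - 1\<close>. In the first alternative \<open>L\<close> and \<open>L'\<close> agree
  under \<open>T\<close>; in the second, \<open>T\<close> violates a linear inequality in
  \<open>X\<close>.\<close>

lemma derivable_square_by_cases:
  assumes n: "1 \<le> n" and V: "V \<subseteq> {..<n}" and L: "affine_pol n L"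
    and B: "n + 1 \<le> B" "card V + 1 \<le> B" "2 ^ card V \<le> B"
    and cases: "\<And>T. T \<subseteq> V \<Longrightarrow>
      (\<exists>L' k. affine_pol n L' \<and> L' ^ 2 - 1 \<in> X \<and> L - L' = deviation V T k) \<or>
      (\<exists>k. deviation V T k - 1 \<in> X)"
  shows "derivable n X (mons n V 5) (50 * B ^ 6) (L ^ 2 - 1)"
proof -
  have fin: "finite V" using V finite_subset by blast
  have B1: "1 \<le> B" using B by simp
  have pw: "B ^ i \<le> B ^ k" if "i \<le> k" for i k
    using that B1 by (intro power_increasing) auto
  have "derivable n X (mons n V 5) (41 * B ^ 5) (indicator_pol V T * (L ^ 2 - 1))" if T: "T \<subseteq> V" for T
    using cases[OF T]
  proof (elim disjE exE conjE)
    fix L' k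
    assume L': "affine_pol n L'" and X: "L' ^ 2 - 1 \<in> X" and dev: "L - L' = deviation V T k"
    have "Poly_Mapping.keys (L' ^ 2) \<subseteq> mons n {} 2"
      by (rule keys_affine_square[OF L'])
    then have "Poly_Mapping.keys (L' ^ 2 - 1) \<subseteq> mons n {} 2"
      using keys_minus_subset[of "L' ^ 2" 1] zero_in_mons[of n "{}" 2] by auto
    then have "derivable n X (mons n {} 2) 1 (L' ^ 2 - 1)" using X by (intro derivable_hyp) auto
    from derivable_mult_indicator[OF this fin V, of T]
    have 1: "derivable n X (mons n V 5) (1 + card V) ((L' ^ 2 - 1) * indicator_pol V T)"
      using mons_mono[of V V 2 5 n] by (auto intro: derivable_mono)
    \<comment> \<open>The correction \<open>L ^ 2 - L' ^ 2 = (L - L') * (L + L')\<close> vanishes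
      against the indicator, because \<open>L - L'\<close> is a deviation from
      \<open>T\<close>.\<close>
    have "derivable n X (mons n V 5) (10 * B ^ 3) (indicator_pol V T * deviation V T k * (L + L'))"
      using vanishing_indicator_mult_deviation[OF n V affine_pol_add[OF L L'] B(1,2), of X T k]
        mons_mono[of V V 3 5 n] by (auto simp: vanishing_def intro: derivable_mono)
    from derivable_add[OF 1 this]
    have "derivable n X (mons n V 5) (Suc (1 + card V + 10 * B ^ 3))
      ((L' ^ 2 - 1) * indicator_pol V T + indicator_pol V T * (L - L') * (L + L'))"
      by (simp add: dev)
    also have "(L' ^ 2 - 1) * indicator_pol V T + indicator_pol V T * (L - L') * (L + L') =
        indicator_pol V T * (L ^ 2 - 1)"
      by (simp add: algebra_simps power2_eq_square)
    finally show ?thesis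
      by (rule derivable_mono) (use B pw[of 1 5] pw[of 3 5] pw[of 0 5] in auto)
  next
    fix k
    assume X: "deviation V T k - 1 \<in> X"
    let ?I = "indicator_pol V T" and ?F = "deviation V T k"
    have "affine_pol n (?F - 1)"
      using affine_pol_diff[OF affine_pol_deviation[OF V] affine_pol_of_int[where c = 1]] by simp
    with X have "derivable n X (mons n {} 1) 1 (?F - 1)"
      by (blast intro: derivable_hyp dest: affine_pol_def[THEN iffD1])
    from derivable_mult_indicator[OF this fin V, of T]
    have 1: "derivable n X (mons n V 3) (1 + card V) ((?F - 1) * ?I)"
      by (rule derivable_mono[OF _ mons_mono]) simp_all
    \<comment> \<open>Since \<open>?I * ?F\<close> vanishes, \<open>(?F - 1) * ?I\<close> turns into
      \<open>- ?I\<close>. As \<open>?I\<close> itself is derivable from 1, the indicator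
      vanishes.\<close>
    have "vanishing n X (mons n V 3) (10 * B ^ 3) (?I * ?F)"
      using vanishing_indicator_mult_deviation[OF n V affine_pol_of_int[where c = 1] B(1,2), of X T k] by simp
    then have "derivable n X (mons n V 3) (10 * B ^ 3) (- (?I * ?F))"
      by (simp add: vanishing_def)
    from derivable_add[OF 1 this]
    have "derivable n X (mons n V 3) (Suc (1 + card V + 10 * B ^ 3)) (- ?I)"
      by (simp add: algebra_simps)
    then have "derivable n X (mons n V 3) (15 * B ^ 3) (- ?I)"
      by (rule derivable_mono[OF _ order_refl]) (use B(2) pw[of 1 3] pw[of 0 3] in simp)
    moreover have "derivable n X (mons n V 3) (3 + card V) ?I"
      using derivable_mult_indicator[OF derivable_one[OF n] fin V, of 3 X T] by simp
    then have "derivable n X (mons n V 3) (15 * B ^ 3) ?I"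
      by (rule derivable_mono[OF _ order_refl]) (use B(2) pw[of 1 3] pw[of 0 3] in simp)
    ultimately have 2: "vanishing n X (mons n V 3) (15 * B ^ 3) ?I"
      unfolding vanishing_def by blast
    \<comment> \<open>The two factors \<open>L\<close> are multiplied one at a time, raising the
      exponent from 3 to 5.\<close>
    have "vanishing n X (mons n V 4) (B * (15 * B ^ 3 + 3) + 2) (?I * L)"
      using vanishing_mult_affine[OF 2 n L B(1)] by simp
    from vanishing_mult_affine[OF this n L B(1)]
    have "derivable n X (mons n V 5) (B * ((B * (15 * B ^ 3 + 3) + 2) + 3) + 2) (?I * L * L)"
      by (simp add: vanishing_def)
    moreover have "derivable n X (mons n V 5) (15 * B ^ 3) (- ?I)"
      using 2 mons_mono[of V V 3 5 n] by (auto simp: vanishing_def intro: derivable_mono)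
    ultimately have "derivable n X (mons n V 5)
        (Suc ((B * ((B * (15 * B ^ 3 + 3) + 2) + 3) + 2) + 15 * B ^ 3)) (?I * L * L + (- ?I))"
      by (rule derivable_add)
    also have "?I * L * L + (- ?I) = ?I * (L ^ 2 - 1)"
      by (simp add: algebra_simps power2_eq_square)
    finally show ?thesis
    proof (rule derivable_mono)
      have "Suc ((B * ((B * (15 * B ^ 3 + 3) + 2) + 3) + 2) + 15 * B ^ 3) =
          15 * B ^ 5 + 3 * B ^ 2 + 5 * B ^ 1 + 15 * B ^ 3 + 3 * B ^ 0"
        by (simp add: algebra_simps eval_nat_numeral)
      also have "\<dots> \<le> 41 * B ^ 5"
        using pw[of 0 5] pw[of 1 5] pw[of 2 5] pw[of 3 5] by linarith
      finally show "Suc ((B * ((B * (15 * B ^ 3 + 3) + 2) + 3) + 2) + 15 * B ^ 3) \<le> 41 * B ^ 5" .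
    qed simp
  qed
  then have "derivable n X (mons n V 5) (card (Pow V) * (41 * B ^ 5 + 1) + 2)
      (\<Sum>T\<in>Pow V. indicator_pol V T * (L ^ 2 - 1))"
    using n fin by (intro derivable_sum) auto
  also have "(\<Sum>T\<in>Pow V. indicator_pol V T * (L ^ 2 - 1)) = L ^ 2 - 1"
    by (simp add: sum_indicator_pol[OF fin] flip: sum_distrib_right)
  finally show ?thesis
  proof (rule derivable_mono)
    have "card (Pow V) * (41 * B ^ 5 + 1) \<le> B * (41 * B ^ 5 + 1)"
      using B(3) fin by (simp only: card_Pow mult_le_mono1)
    also have "\<dots> = 41 * B ^ 6 + B ^ 1" by (simp add: algebra_simps eval_nat_numeral)
    finally show "card (Pow V) * (41 * B ^ 5 + 1) + 2 \<le> 50 * B ^ 6"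
      using pw[of 1 6] pw[of 0 6] by simp
  qed simp
qed

subsection \<open>Sequences of derivations\<close>

text \<open>All of \<open>F\<close> sits in one proof, so that later derivations can use its lines
  repeatedly; the resulting refutation is not meant to be tree-like.\<close>

definition reachable :: "nat \<Rightarrow> mpol set \<Rightarrow> nat \<Rightarrow> nat \<Rightarrow> mpol set \<Rightarrow> bool" where
  "reachable n H d s F \<longleftrightarrow> (\<exists>ps. sa_proof n H ps \<and> F \<subseteq> set ps \<and> proof_size ps \<le> s \<and>
     (\<forall>Q\<in>set ps. total_degree Q \<le> d))"

lemma reachable_mono:
  "reachable n H d s F \<Longrightarrow> G \<subseteq> F \<Longrightarrow> s \<le> t \<Longrightarrow> reachable n H d t G"
  unfolding reachable_def by (meson order_trans)

section \<open>From supports and numbers of lines to degree and size\<close>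

lemma pol_size_le:
  assumes "Poly_Mapping.keys P \<subseteq> M" "finite M" "\<And>u. u \<in> M \<Longrightarrow> mon_degree u \<le> d"
  shows "pol_size P \<le> card M * d"
proof -
  have "pol_size P \<le> card (Poly_Mapping.keys P) * d"
    unfolding pol_size_def using assms by (intro sum_bounded_above[where K = d, simplified]) auto
  also have "\<dots> \<le> card M * d" using assms by (intro mult_le_mono1 card_mono)
  finally show ?thesis .
qed

lemma total_degree_le:
  assumes "Poly_Mapping.keys P \<subseteq> M" "\<And>u. u \<in> M \<Longrightarrow> mon_degree u \<le> d"
  shows "total_degree P \<le> d"
  unfolding total_degree_def using assms by auto

lemma proof_size_append: "proof_size (ps @ qs) = proof_size ps + proof_size qs"
  by (simp add: proof_size_def)

lemma proof_size_le:
  assumes "\<And>Q. Q \<in> set ps \<Longrightarrow> pol_size Q \<le> s"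
  shows "proof_size ps \<le> length ps * s"
  using assms by (induction ps) (auto simp: proof_size_def add_mono)

text \<open>The derivations of the members of \<open>G\<close> are appended one after another to the
  same proof, so \<open>F\<close> is paid for only once.\<close>

lemma reachable_extend:
  assumes reach: "reachable n H d s F"
    and M: "finite M" "\<And>u. u \<in> M \<Longrightarrow> mon_degree u \<le> d"
    and fin: "finite G" and G: "\<And>P. P \<in> G \<Longrightarrow> derivable n (H \<union> F) M N P"
  shows "reachable n H d (s + card G * (N * (card M * d))) (F \<union> G)"
  using fin G
proof (induction G rule: finite_induct)
  case empty
  then show ?case using reach by simp
next
  case (insert P G)
  then obtain ps where ps: "sa_proof n H ps" "F \<union> G \<subseteq> set ps"
      "proof_size ps \<le> s + card G * (N * (card M * d))" "\<forall>Q\<in>set ps. total_degree Q \<le> d"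
    unfolding reachable_def by auto
  obtain qs where qs: "sa_proof n (H \<union> F) qs" "P \<in> set qs" "length qs \<le> N"
      "\<forall>Q\<in>set qs. Poly_Mapping.keys Q \<subseteq> M"
    using insert.prems[of P] unfolding derivable_def by auto
  have "sa_proof n (H \<union> set ps) qs"
    using qs(1) ps(2) by (auto intro: sa_proof_mono)
  then have "sa_proof n H (ps @ qs)" by (rule sa_proof_append[OF ps(1)])
  moreover have "F \<union> insert P G \<subseteq> set (ps @ qs)" using ps(2) qs(2) by auto
  moreover have "\<forall>Q\<in>set (ps @ qs). total_degree Q \<le> d"
    using ps(4) qs(4) M total_degree_le[of _ M d] by auto
  moreover have "proof_size qs \<le> length qs * (card M * d)"
    using qs(4) M by (intro proof_size_le pol_size_le) auto
  then have "proof_size qs \<le> N * (card M * d)"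
    using mult_le_mono1[OF qs(3)] le_trans by blast
  then have "proof_size (ps @ qs) \<le> s + card (insert P G) * (N * (card M * d))"
    using ps(3) insert.hyps by (simp add: proof_size_append)
  ultimately show ?case unfolding reachable_def by blast
qed

text \<open>Every member of \<open>G\<close> costs \<open>50 * B ^ 6\<close> lines with at most
  \<open>B ^ 6\<close> monomials of degree at most \<open>6 * B\<close>.\<close>

lemma reachable_step:
  assumes reach: "reachable n H (w + 5) s F"
    and V: "V \<subseteq> {..<n}" "card V \<le> w" and B: "n + 1 \<le> B" "w + 1 \<le> B" "2 ^ w \<le> B"
    and fin: "finite G" and G: "\<And>P. P \<in> G \<Longrightarrow> derivable n (H \<union> F) (mons n V 5) (50 * B ^ 6) P"
  shows "reachable n H (w + 5) (s + card G * (300 * B ^ 13)) G"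
proof -
  have finV: "finite V" using V finite_subset by blast
  have deg: "mon_degree u \<le> w + 5" if "u \<in> mons n V 5" for u
    using mon_degree_mons[OF finV that] V by simp
  have "card (mons n V 5) \<le> (n + 1) ^ 5 * 2 ^ card V"
    by (rule card_mons[OF finV])
  also have "\<dots> \<le> B ^ 5 * 2 ^ w"
    using B V by (intro mult_le_mono power_mono power_increasing) auto
  also have "\<dots> \<le> B ^ 5 * B" using B by simp
  finally have "card (mons n V 5) * (w + 5) \<le> (B ^ 5 * B) * (6 * B)"
    using B by (intro mult_le_mono) auto
  then have "50 * B ^ 6 * (card (mons n V 5) * (w + 5)) \<le> 50 * B ^ 6 * ((B ^ 5 * B) * (6 * B))"
    by (rule mult_le_mono2)
  also have "\<dots> = 300 * B ^ 13" by (simp add: algebra_simps eval_nat_numeral)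
  finally have "50 * B ^ 6 * (card (mons n V 5) * (w + 5)) \<le> 300 * B ^ 13" .
  then have "s + card G * (50 * B ^ 6 * (card (mons n V 5) * (w + 5))) \<le> s + card G * (300 * B ^ 13)"
    by simp
  then show ?thesis
    using reachable_extend[OF reach finite_mons[OF finV] deg fin G] by (auto intro: reachable_mono)
qed

subsection \<open>Adding up and eliminating\<close>

text \<open>Where \<open>D\<close> takes an integer value, the inequality says that this value
  differs from \<open>c\<close>.\<close>

definition parity_line :: "mpol \<Rightarrow> int \<Rightarrow> mpol" where
  "parity_line D c = (D - of_int c) ^ 2 - 1"

lemma card_parity_lines:
  assumes "\<And>c. c \<in> C \<Longrightarrow> \<bar>c\<bar> \<le> int R"
  shows "finite (parity_line D ` C)" "card (parity_line D ` C) \<le> 2 * R + 1"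
proof -
  have C: "C \<subseteq> {- int R..int R}" using assms by (force simp: abs_le_iff)
  then show "finite (parity_line D ` C)" using finite_subset by blast
  have "card (parity_line D ` C) \<le> card C"
    using C finite_subset by (blast intro: card_image_le)
  also have "\<dots> \<le> card {- int R..int R}" using C by (intro card_mono) auto
  also have "\<dots> = 2 * R + 1" by simp
  finally show "card (parity_line D ` C) \<le> 2 * R + 1" .
qed

section \<open>Integer sums of rows and the clauses of a row\<close>

definition parity_pol :: "('i \<Rightarrow> nat set) \<Rightarrow> 'i set \<Rightarrow> mpol" where
  "parity_pol V J = (\<Sum>i\<in>J. \<Sum>j\<in>V i. Var j)"

text \<open>The form of the clauses in \<open>enc_row\<close>. For \<open>T \<subseteq> V\<close> it
  excludes exactly those 0/1 points that agree with \<open>T\<close> on \<open>V\<close>.\<close>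

definition parity_clause :: "nat set \<Rightarrow> nat set \<Rightarrow> mpol" where
  "parity_clause V T = ((\<Sum>i\<in>T. 1 - Var i) + (\<Sum>i\<in>V - T. Var i)) - 1"

text \<open>Because \<open>1 - x_j = - (x_j - 1)\<close>, the coefficients are -1 on
  \<open>T\<close>. This is the shape of the second alternative in
  \<open>derivable_square_by_cases\<close>.\<close>

lemma parity_clause_eq:
  assumes "finite V" "T \<subseteq> V"
  shows "parity_clause V T = deviation V T (\<lambda>j. if j \<in> T then - 1 else 1) - 1"
proof -
  let ?f = "\<lambda>j. Const (if j \<in> T then - 1 else 1) * (Var j - of_bool (j \<in> T))"
  have "deviation V T (\<lambda>j. if j \<in> T then - 1 else 1) = sum ?f (V - T) + sum ?f T"
    unfolding deviation_def by (rule sum.subset_diff[OF assms(2,1)])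
  also have "sum ?f (V - T) = (\<Sum>j\<in>V - T. Var j)" by (intro sum.cong) auto
  also have "sum ?f T = (\<Sum>j\<in>T. 1 - Var j)" by (intro sum.cong) auto
  finally show ?thesis by (simp add: parity_clause_def add.commute)
qed

text \<open>Under \<open>T\<close> the sum has the value \<open>card T\<close>. This supplies
  \<open>L - L'\<close> for the first alternative in
  \<open>derivable_square_by_cases\<close>.\<close>

lemma sum_Var_deviation:
  assumes "finite V" "T \<subseteq> V"
  shows "(\<Sum>j\<in>V. Var j) - of_nat (card T) = deviation V T (\<lambda>_. 1)"
proof -
  have "(\<Sum>j\<in>V. of_bool (j \<in> T) :: mpol) = (\<Sum>j\<in>T. 1)"
    using assms by (intro sum.mono_neutral_cong_right) auto
  then show ?thesis
    unfolding deviation_def by (simp add: sum_subtractf)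
qed

text \<open>The range of \<open>c\<close> shrinks by \<open>w\<close> with every row, since the line for \<open>c\<close> is derived from lines
  for \<open>c - |T|\<close>, where \<open>|T| \<le> w\<close>.\<close>
definition row_lines :: "('i \<Rightarrow> nat set) \<Rightarrow> ('i \<Rightarrow> bit) \<Rightarrow> nat \<Rightarrow> nat \<Rightarrow> 'i set \<Rightarrow> mpol set" where
  "row_lines V b w R J = parity_line (parity_pol V J) `
     {c. of_int c = 1 + sum b J \<and> \<bar>c\<bar> + int (w * card J) \<le> int R}"

lemma affine_pol_parity_line:
  "affine_pol n D \<Longrightarrow> affine_pol n (D - of_int c)"
  by (intro affine_pol_diff affine_pol_of_int)

lemma bit_cases: "x = b \<or> x = 1 - b" for x b :: bit
  by (cases x; cases b) auto

text \<open>Rows are added one by one. Each of the \<open>card J + 1\<close> stages has at most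
  \<open>2 * R + 1\<close> lines at a cost of \<open>300 * B ^ 13\<close>.\<close>

lemma reachable_row_lines:
  assumes n: "1 \<le> n" and B: "n + 1 \<le> B" "w + 1 \<le> B" "2 ^ w \<le> B"
    and V: "\<And>i. i \<in> I \<Longrightarrow> V i \<subseteq> {..<n}" "\<And>i. i \<in> I \<Longrightarrow> card (V i) \<le> w"
    and H: "\<And>i T. i \<in> I \<Longrightarrow> T \<subseteq> V i \<Longrightarrow> of_nat (card T) = 1 - b i \<Longrightarrow> parity_clause (V i) T \<in> H"
    and J: "finite J" "J \<subseteq> I"
  shows "reachable n H (w + 5) ((card J + 1) * ((2 * R + 1) * (300 * B ^ 13))) (row_lines V b w R J)"
  using J
proof (induction J rule: finite_induct)
  case empty
  let ?C = "{c. of_int c = (1 :: bit) \<and> \<bar>c\<bar> \<le> int R}"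
  have lines: "row_lines V b w R {} = parity_line (parity_pol V {}) ` ?C"
    by (simp add: row_lines_def)
  note R = card_parity_lines[of ?C R "parity_pol V {}"]
  have "reachable n H (w + 5) 0 {}"
    unfolding reachable_def by (rule exI[of _ "[]"]) (auto simp: proof_size_def)
  moreover have "derivable n (H \<union> {}) (mons n {} 5) (50 * B ^ 6) (parity_line (parity_pol V {}) c)"
    if "c \<in> ?C" for c
  proof -
    \<comment> \<open>Here the form is 0 and \<open>c\<close> is odd, so the line is a non-negative
      constant, a multiple of 1.\<close>
    have "c \<noteq> 0" using that by auto
    then have "0 \<le> c ^ 2 - 1" using zero_less_power2[of c] by linarith
    then have "0 \<le> rat_of_int (c ^ 2 - 1)" by (rule of_int_0_le_iff[THEN iffD2])
    from derivable_scale[OF derivable_one[OF n, of 5 H "{}"] this]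
    have "derivable n H (mons n {} 5) (Suc 3) (Const (of_int (c ^ 2 - 1)) * 1)" by simp
    also have "Const (of_int (c ^ 2 - 1)) * 1 = parity_line (parity_pol V {}) c"
      by (simp only: Const_of_int) (simp add: parity_line_def parity_pol_def)
    finally have "derivable n H (mons n {} 5) (Suc 3) (parity_line (parity_pol V {}) c)" .
    moreover have "1 \<le> B ^ 6" using B(1) by (intro one_le_power) simp
    then have "Suc 3 \<le> 50 * B ^ 6" by simp
    ultimately show ?thesis by (auto intro: derivable_mono)
  qed
  ultimately have "reachable n H (w + 5) (0 + card (row_lines V b w R {}) * (300 * B ^ 13)) (row_lines V b w R {})"
    using B R(1) unfolding lines
    by (intro reachable_step[where V = "{}" and F = "{}"]) auto
  then show ?case
    by (rule reachable_mono)
      (use mult_le_mono1[OF R(2), of "300 * B ^ 13"] in \<open>simp_all add: lines\<close>)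
next
  case (insert i J)
  let ?C = "{c. of_int c = 1 + sum b (insert i J) \<and> \<bar>c\<bar> + int (w * card (insert i J)) \<le> int R}"
  let ?D = "parity_pol V J" and ?D' = "parity_pol V (insert i J)"
  have i: "i \<in> I" and JI: "J \<subseteq> I" using insert by auto
  have finV: "finite (V i)" using V(1)[OF i] finite_subset by blast
  have aff: "affine_pol n (parity_pol V K)" if "K \<subseteq> I" for K
    unfolding parity_pol_def using that V(1) by (intro affine_pol_sum affine_pol_Var) blast
  have D': "?D' = ?D + (\<Sum>j\<in>V i. Var j)"
    using insert.hyps by (simp add: parity_pol_def add.commute)
  have *: "derivable n (H \<union> row_lines V b w R J) (mons n (V i) 5) (50 * B ^ 6) (parity_line ?D' c)"
    if c: "c \<in> ?C" for c
    unfolding parity_line_def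
  proof (rule derivable_square_by_cases)
    fix T assume T: "T \<subseteq> V i"
    have "card T \<le> card (V i)" using T finV by (rule card_mono[rotated])
    then have cT: "card T \<le> w" using V(2)[OF i] by simp
    from bit_cases[of "of_nat (card T)" "b i"]
    show "(\<exists>L' k. affine_pol n L' \<and> L' ^ 2 - 1 \<in> H \<union> row_lines V b w R J \<and>
        ?D' - of_int c - L' = deviation (V i) T k) \<or>
      (\<exists>k. deviation (V i) T k - 1 \<in> H \<union> row_lines V b w R J)"
    proof
      assume par: "of_nat (card T) = b i"
      \<comment> \<open>If \<open>T\<close> satisfies the row, the sum of the row contributes
        \<open>card T\<close>, and shifting \<open>c\<close> by it removes \<open>b i\<close> from
        the parity condition.\<close>
      let ?c = "c - int (card T)"
      have "of_int ?c = of_int c - (of_nat (card T) :: bit)" by simp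
      also have "\<dots> = 1 + sum b J"
        using c insert.hyps unfolding par by simp
      finally have "of_int ?c = 1 + sum b J" .
      moreover have "\<bar>?c\<bar> + int (w * card J) \<le> int R"
        using c insert.hyps cT by (auto simp: algebra_simps)
      ultimately have "parity_line ?D ?c \<in> row_lines V b w R J"
        unfolding row_lines_def by blast
      moreover have "?D' - of_int c - (?D - of_int ?c) = deviation (V i) T (\<lambda>_. 1)"
        using sum_Var_deviation[OF finV T] by (simp add: D' algebra_simps)
      ultimately show ?thesis
        using affine_pol_parity_line[OF aff[OF JI], of ?c] unfolding parity_line_def by blast
    next
      \<comment> \<open>If \<open>T\<close> violates the row, a clause excludes it.\<close>
      assume "of_nat (card T) = 1 - b i"
      from H[OF i T this] show ?thesis
        unfolding parity_clause_eq[OF finV T] by blast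
    qed
  next
    show "affine_pol n (?D' - of_int c)"
      using insert.prems by (intro affine_pol_parity_line aff)
    show "card (V i) + 1 \<le> B" using V(2)[OF i] B by simp
    show "2 ^ card (V i) \<le> B"
      using order_trans[OF power_increasing[OF V(2)[OF i]] B(3)] by simp
  qed (use n B V(1)[OF i] in auto)
  have "derivable n (H \<union> row_lines V b w R J) (mons n (V i) 5) (50 * B ^ 6) P"
    if "P \<in> row_lines V b w R (insert i J)" for P
    using that * unfolding row_lines_def[of V b w R "insert i J"] by blast
  moreover have fin: "finite (row_lines V b w R (insert i J))"
    unfolding row_lines_def by (rule card_parity_lines(1)[of _ R]) (auto simp del: of_nat_mult)
  ultimately have "reachable n H (w + 5) ((card J + 1) * ((2 * R + 1) * (300 * B ^ 13)) +
      card (row_lines V b w R (insert i J)) * (300 * B ^ 13)) (row_lines V b w R (insert i J))"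
    using B V i insert.IH[OF JI] fin
    by (intro reachable_step[where V = "V i" and F = "row_lines V b w R J"]) auto
  then show ?case
  proof (rule reachable_mono)
    have "card (row_lines V b w R (insert i J)) \<le> 2 * R + 1"
      unfolding row_lines_def by (rule card_parity_lines(2)) (auto simp del: of_nat_mult)
    from mult_le_mono1[OF this, of "300 * B ^ 13"]
    show "(card J + 1) * ((2 * R + 1) * (300 * B ^ 13)) +
        card (row_lines V b w R (insert i J)) * (300 * B ^ 13)
      \<le> (card (insert i J) + 1) * ((2 * R + 1) * (300 * B ^ 13))"
      using insert.hyps by simp
  qed simp
qed

text \<open>Evenness of \<open>d l\<close> keeps \<open>c + d l\<close> even, so the lines for both
  values of \<open>x_l\<close> are available. The range of \<open>c\<close> shrinks by
  \<open>d l\<close> when \<open>x_l\<close> is removed.\<close>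

lemma reachable_elimination:
  assumes n: "1 \<le> n" and w: "1 \<le> w" and B: "n + 1 \<le> B" "w + 1 \<le> B" "2 ^ w \<le> B"
    and even: "\<And>j. j < n \<Longrightarrow> of_nat (d j) = (0 :: bit)"
    and start: "reachable n H (w + 5) s
      (parity_line (\<Sum>j\<in>{0..<n}. of_nat (d j) * Var j) ` {c. of_int c = (0 :: bit) \<and> \<bar>c\<bar> \<le> int R})"
    and l: "l \<le> n"
  shows "reachable n H (w + 5) (s + l * ((2 * R + 1) * (300 * B ^ 13)))
    (parity_line (\<Sum>j\<in>{l..<n}. of_nat (d j) * Var j) `
       {c. of_int c = (0 :: bit) \<and> \<bar>c\<bar> + int (sum d {..<l}) \<le> int R})"
  using l
proof (induction l)
  case 0
  then show ?case using start by simp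
next
  case (Suc l)
  let ?D = "\<lambda>l. \<Sum>j\<in>{l..<n}. of_nat (d j) * Var j"
  let ?C = "\<lambda>l. {c. of_int c = (0 :: bit) \<and> \<bar>c\<bar> + int (sum d {..<l}) \<le> int R}"
  let ?F = "\<lambda>l. parity_line (?D l) ` ?C l"
  have ln: "l < n" using Suc.prems by simp
  have aff: "affine_pol n (?D k)" for k
  proof -
    have "affine_pol n (of_nat (d j) * Var j)" if "j < n" for j
      using affine_pol_Const_mult[OF affine_pol_Var[OF that], of "of_int (int (d j))"]
      unfolding Const_of_int by simp
    then show ?thesis by (intro affine_pol_sum) auto
  qed
  have D: "?D l = of_nat (d l) * Var l + ?D (Suc l)"
    using ln by (simp add: sum.atLeast_Suc_lessThan)
  have "derivable n (H \<union> ?F l) (mons n {l} 5) (50 * B ^ 6) (parity_line (?D (Suc l)) c)"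
    if c: "c \<in> ?C (Suc l)" for c
  proof (rule derivable_square_by_cases[where L = "?D (Suc l) - of_int c", folded parity_line_def[of "?D (Suc l)" c]])
    fix T assume T: "T \<subseteq> {l}"
    \<comment> \<open>If \<open>x_l = 1\<close>, the form still containing \<open>x_l\<close> is
      larger by \<open>d l\<close>, so \<open>c\<close> is shifted along.\<close>
    let ?c = "c + int (d l) * of_bool (l \<in> T)"
    have "of_int ?c = (0 :: bit)"
      using c even[OF ln] by simp
    moreover have "\<bar>?c\<bar> + int (sum d {..<l}) \<le> int R"
      using c by auto
    ultimately have "?c \<in> ?C l" by (intro CollectI conjI)
    then have "parity_line (?D l) ?c \<in> ?F l" by (rule imageI)
    then have "(?D l - of_int ?c) ^ 2 - 1 \<in> H \<union> ?F l"
      by (subst parity_line_def[symmetric]) (rule UnI2)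
    moreover have "?D (Suc l) - of_int c - (?D l - of_int ?c) = deviation {l} T (\<lambda>_. of_int (- int (d l)))"
      unfolding deviation_def Const_of_int D by (simp add: algebra_simps)
    moreover have "affine_pol n (?D l - of_int ?c)"
      by (rule affine_pol_parity_line[OF aff])
    ultimately show "(\<exists>L' k. affine_pol n L' \<and> L' ^ 2 - 1 \<in> H \<union> ?F l \<and>
        ?D (Suc l) - of_int c - L' = deviation {l} T k) \<or>
      (\<exists>k. deviation {l} T k - 1 \<in> H \<union> ?F l)"
      by (intro disjI1 exI conjI)
  next
    show "affine_pol n (?D (Suc l) - of_int c)"
      by (rule affine_pol_parity_line[OF aff])
  qed (use n w B ln in auto)
  moreover have "finite (?F (Suc l))"
    by (rule card_parity_lines(1)[of _ R]) (auto simp del: of_nat_sum)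
  ultimately have "reachable n H (w + 5) (s + l * ((2 * R + 1) * (300 * B ^ 13)) +
      card (?F (Suc l)) * (300 * B ^ 13)) (?F (Suc l))"
    using w B ln Suc.IH
    by (intro reachable_step[where V = "{l}" and F = "?F l"]) auto
  then show ?case
  proof (rule reachable_mono)
    have "card (?F (Suc l)) \<le> 2 * R + 1"
      by (rule card_parity_lines(2)) (auto simp del: of_nat_sum)
    from mult_le_mono1[OF this, of "300 * B ^ 13"]
    show "s + l * ((2 * R + 1) * (300 * B ^ 13)) + card (?F (Suc l)) * (300 * B ^ 13)
        \<le> s + Suc l * ((2 * R + 1) * (300 * B ^ 13))"
      by simp
  qed simp
qed

subsection \<open>Small unsatisfiable subsystems\<close>

text \<open>Gaussian elimination by induction on the number of columns: either there is a solution
  or some combination of the rows reads \<open>0 = 1\<close>.\<close>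

lemma linear_system_alternative:
  fixes a :: "nat \<Rightarrow> nat \<Rightarrow> 'a :: field"
  shows "(\<exists>x. \<forall>i<m. (\<Sum>j<n. a i j * x j) = b i) \<or>
    (\<exists>y. (\<forall>j<n. (\<Sum>i<m. y i * a i j) = 0) \<and> (\<Sum>i<m. y i * b i) = 1)"
proof (induction n arbitrary: a b)
  case 0
  show ?case
  proof (cases "\<forall>i<m. b i = 0")
    case False
    then obtain p where p: "p < m" "b p \<noteq> 0" by blast
    have "(\<Sum>i<m. (if i = p then 1 / b p else 0) * b i) = (\<Sum>i<m. if i = p then 1 else 0)"
      using p by (intro sum.cong) auto
    also have "\<dots> = 1" using p by simp
    finally show ?thesis by auto
  qed simp
next
  case (Suc n)
  show ?case
  proof (cases "\<forall>i<m. a i n = 0")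
    case True
    from Suc.IH[of a b] show ?thesis
    proof (elim disjE exE conjE)
      fix x assume "\<forall>i<m. (\<Sum>j<n. a i j * x j) = b i"
      then show ?thesis using True by auto
    next
      fix y assume "\<forall>j<n. (\<Sum>i<m. y i * a i j) = 0" "(\<Sum>i<m. y i * b i) = 1"
      then show ?thesis using True by (auto simp: less_Suc_eq)
    qed
  next
    case False
    then obtain p where p: "p < m" "a p n \<noteq> 0" by blast
    \<comment> \<open>Subtracting \<open>r i\<close> times row \<open>p\<close> clears column
      \<open>n\<close>. Row \<open>p\<close> itself becomes zero, so \<open>m\<close> need not
      change.\<close>
    define r where "r i = a i n / a p n" for i
    have r: "r i * a p n = a i n" for i using p by (simp add: r_def)
    from Suc.IH[of "\<lambda>i j. a i j - r i * a p j" "\<lambda>i. b i - r i * b p"] show ?thesis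
    proof (elim disjE exE conjE)
      fix x assume x: "\<forall>i<m. (\<Sum>j<n. (a i j - r i * a p j) * x j) = b i - r i * b p"
      \<comment> \<open>The last variable is determined by the pivot row.\<close>
      define z where "z = (b p - (\<Sum>j<n. a p j * x j)) / a p n"
      have "(\<Sum>j<Suc n. a i j * (x(n := z)) j) = b i" if "i < m" for i
      proof -
        have "(\<Sum>j<n. a i j * x j) - r i * (\<Sum>j<n. a p j * x j) = b i - r i * b p"
          using x that by (simp add: left_diff_distrib sum_subtractf sum_distrib_left mult.assoc)
        then have 1: "(\<Sum>j<n. a i j * x j) = b i - r i * b p + r i * (\<Sum>j<n. a p j * x j)"
          by (simp only: diff_eq_eq)
        have 2: "a i n * z = r i * (b p - (\<Sum>j<n. a p j * x j))"
          by (simp add: z_def r_def)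
        have "(\<Sum>j<n. a i j * x j) + a i n * z = b i"
          unfolding 1 2 by (simp add: algebra_simps)
        then show ?thesis by simp
      qed
      then show ?thesis by blast
    next
      fix y assume y: "\<forall>j<n. (\<Sum>i<m. y i * (a i j - r i * a p j)) = 0"
        "(\<Sum>i<m. y i * (b i - r i * b p)) = 1"
      \<comment> \<open>All subtracted multiples of row \<open>p\<close> are charged to the
        coefficient of row \<open>p\<close>.\<close>
      define z where "z i = y i - (if i = p then \<Sum>k<m. y k * r k else 0)" for i
      have z: "(\<Sum>i<m. z i * f i) = (\<Sum>i<m. y i * (f i - r i * f p))" for f
      proof -
        have "(\<Sum>i<m. z i * f i) =
            (\<Sum>i<m. y i * f i) - (\<Sum>i<m. if i = p then (\<Sum>k<m. y k * r k) * f p else 0)"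
          unfolding sum_subtractf[symmetric] by (intro sum.cong) (auto simp: z_def algebra_simps)
        also have "\<dots> = (\<Sum>i<m. y i * f i) - (\<Sum>k<m. y k * r k) * f p"
          using p by simp
        finally show ?thesis
          by (simp add: right_diff_distrib sum_subtractf sum_distrib_right mult.assoc)
      qed
      have "(\<Sum>i<m. z i * a i j) = 0" if "j < Suc n" for j
        using that y(1) r unfolding z by (auto simp: less_Suc_eq)
      moreover have "(\<Sum>i<m. z i * b i) = 1" unfolding z by (rule y(2))
      ultimately show ?thesis by blast
    qed
  qed
qed

text \<open>The part over \<open>J \<inter> K\<close> is counted twice on the right and cancels in
  characteristic 2.\<close>

lemma sum_bit_symmetric_difference:
  fixes f :: "'i \<Rightarrow> bit"
  assumes "finite J" "finite K"
  shows "sum f ((J - K) \<union> (K - J)) = sum f J + sum f K"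
proof -
  have "sum f J = sum f (J \<inter> K) + sum f (J - K)"
    by (rule sum.Int_Diff[OF assms(1)])
  moreover have "sum f K = sum f (J \<inter> K) + sum f (K - J)"
    unfolding Int_commute[of J K] by (rule sum.Int_Diff[OF assms(2)])
  moreover have "sum f ((J - K) \<union> (K - J)) = sum f (J - K) + sum f (K - J)"
    using assms by (intro sum.union_disjoint) auto
  ultimately show ?thesis
    by (cases "sum f (J \<inter> K)"; cases "sum f (J - K)"; cases "sum f (K - J)") simp_all
qed

text \<open>If two subsets of a minimal core without \<open>i\<^sub>0\<close> had the same sum of rows, their symmetric
  difference or its complement would be a smaller core. So there are at most \<open>2\<^sup>n\<close> such subsets.\<close>
lemma small_unsatisfiable_core:
  fixes a :: "nat \<Rightarrow> nat \<Rightarrow> bit"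
  assumes "\<nexists>x. \<forall>i<m. (\<Sum>j<n. a i j * x j) = b i"
  obtains I where "I \<subseteq> {..<m}" "card I \<le> n + 1" "\<And>j. j < n \<Longrightarrow> (\<Sum>i\<in>I. a i j) = 0" "sum b I = 1"
proof -
  define core where "core I \<longleftrightarrow> I \<subseteq> {..<m} \<and> (\<forall>j<n. (\<Sum>i\<in>I. a i j) = 0) \<and> sum b I = 1" for I
  obtain y where y: "\<forall>j<n. (\<Sum>i<m. y i * a i j) = 0" "(\<Sum>i<m. y i * b i) = 1"
    using linear_system_alternative[where m = m and n = n and a = a and b = b] assms by blast
  \<comment> \<open>Over the two-element field a linear combination is a sum over a subset.\<close>
  have "(\<Sum>i<m. y i * f i) = sum f {i \<in> {..<m}. y i = 1}" for f
  proof -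
    have "y i * f i = (if y i = 1 then f i else 0)" for i by (cases "y i") auto
    then show ?thesis by (simp only: sum.inter_filter[OF finite_lessThan])
  qed
  with y have "core {i \<in> {..<m}. y i = 1}" unfolding core_def by auto
  then obtain I where I: "core I" and least: "\<And>J. core J \<Longrightarrow> card I \<le> card J"
    using ex_has_least_nat[of core _ card] by metis
  have fin: "finite I" using I unfolding core_def using finite_subset by blast
  have "I \<noteq> {}" using I unfolding core_def by auto
  then obtain i0 where i0: "i0 \<in> I" by blast
  have no_core: "\<not> core J" if "J \<subset> I" for J
    using least[of J] psubset_card_mono[OF fin that] by auto
  let ?\<phi> = "\<lambda>J. {j \<in> {..<n}. (\<Sum>i\<in>J. a i j) = 1}"
  have "inj_on ?\<phi> (Pow (I - {i0}))"
  proof (rule inj_onI, rule ccontr)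
    fix J K assume J: "J \<in> Pow (I - {i0})" and K: "K \<in> Pow (I - {i0})" and eq: "?\<phi> J = ?\<phi> K" and "J \<noteq> K"
    define D where "D = (J - K) \<union> (K - J)"
    \<comment> \<open>Neither \<open>J\<close> nor \<open>K\<close> contains \<open>i0\<close>,
      which makes \<open>D\<close> proper; \<open>D\<close> being non-empty makes its complement
      proper.\<close>
    have D: "D \<noteq> {}" "D \<subset> I" "I - D \<subset> I" using J K i0 \<open>J \<noteq> K\<close> by (auto simp: D_def)
    have "finite J" "finite K" using J K fin finite_subset by blast+
    note sum_D = sum_bit_symmetric_difference[OF this, folded D_def]
    have aD: "(\<Sum>i\<in>D. a i j) = 0" if "j < n" for j
    proof -
      have "(\<Sum>i\<in>J. a i j) = 1 \<longleftrightarrow> (\<Sum>i\<in>K. a i j) = 1" using eq that by blast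
      then show ?thesis unfolding sum_D
        by (cases "\<Sum>i\<in>J. a i j"; cases "\<Sum>i\<in>K. a i j") auto
    qed
    have "sum f I = sum f (I - D) + sum f D" for f :: "nat \<Rightarrow> bit"
      using D(2) fin by (intro sum.subset_diff) auto
    then have "(\<forall>j<n. (\<Sum>i\<in>I - D. a i j) = 0) \<and> sum b (I - D) + sum b D = 1"
      using I aD unfolding core_def by fastforce
    \<comment> \<open>By minimality \<open>D\<close> is not a core, so the right-hand side 1 is left
      to \<open>I - D\<close>.\<close>
    moreover have "sum b D \<noteq> 1"
      using no_core[OF D(2)] D(2) I aD unfolding core_def by blast
    then have "sum b D = 0" by simp
    ultimately have "core (I - D)" using I unfolding core_def by auto
    then show False using no_core[OF D(3)] by blast
  qed
  \<comment> \<open>This reads \<open>2 ^ (card I - 1) \<le> 2 ^ n\<close>.\<close>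
  then have "card (Pow (I - {i0})) \<le> card (Pow {..<n})"
    by (rule card_inj_on_le) auto
  then have "card (I - {i0}) \<le> n" using fin by (simp add: card_Pow)
  then have "card I \<le> n + 1" using i0 fin by simp
  with I show ?thesis using that unfolding core_def by blast
qed

subsection \<open>Refutations\<close>

text \<open>A proof may be cut off after any line; here it is cut after an occurrence of
  \<open>- 1\<close>.\<close>

lemma reachable_refutation:
  assumes "reachable n H d s F" "- 1 \<in> F"
  obtains ps where "sa_refutation n H ps" "proof_size ps \<le> s" "proof_degree ps \<le> d"
proof -
  obtain ps where ps: "sa_proof n H ps" "- 1 \<in> set ps" "proof_size ps \<le> s"
      "\<forall>Q\<in>set ps. total_degree Q \<le> d"
    using assms unfolding reachable_def by blast
  obtain us vs where split: "ps = us @ (- 1) # vs"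
    using split_list[OF ps(2)] by blast
  let ?rs = "us @ [- 1]"
  have "sa_proof n H ?rs"
    unfolding sa_proof_def
  proof (intro allI impI)
    fix k assume k: "k < length ?rs"
    then have "?rs ! k = ps ! k" "take k ?rs = take k ps" "k < length ps"
      by (auto simp: split nth_append)
    then show "?rs ! k \<in> H \<or> ?rs ! k \<in> sa_axioms n \<or> infers n (set (take k ?rs)) (?rs ! k)"
      using ps(1) unfolding sa_proof_def by metis
  qed
  then have "sa_refutation n H ?rs" by (simp add: sa_refutation_def)
  moreover have "proof_size ?rs \<le> s"
    using ps(3) by (simp add: split proof_size_def)
  moreover have "proof_degree ?rs \<le> d"
    using ps(4) unfolding proof_degree_def split by auto
  ultimately show ?thesis using that by blast
qed

text \<open>Exchanging the sums collects the coefficient of \<open>x_j\<close>, the number of rows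
  in \<open>I\<close> that contain \<open>j\<close>.\<close>

lemma parity_pol_eq_sum:
  assumes "finite I" "\<And>i. i \<in> I \<Longrightarrow> V i \<subseteq> {..<n}"
  shows "parity_pol V I = (\<Sum>j\<in>{0..<n}. of_nat (card {i \<in> I. j \<in> V i}) * Var j)"
proof -
  have "(\<Sum>j\<in>V i. Var j) = (\<Sum>j\<in>{0..<n}. if j \<in> V i then Var j else 0)" if "i \<in> I" for i
    using assms(2)[OF that] by (intro sum.mono_neutral_cong_left) auto
  then have "parity_pol V I = (\<Sum>i\<in>I. \<Sum>j\<in>{0..<n}. if j \<in> V i then Var j else 0)"
    unfolding parity_pol_def by (rule sum.cong[OF refl])
  also have "\<dots> = (\<Sum>j\<in>{0..<n}. \<Sum>i\<in>I. if j \<in> V i then Var j else 0)"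
    by (rule sum.swap)
  also have "\<dots> = (\<Sum>j\<in>{0..<n}. of_nat (card {i \<in> I. j \<in> V i}) * Var j)"
    using assms(1) by (intro sum.cong refl) (simp flip: sum.inter_filter)
  finally show ?thesis .
qed

text \<open>Incidences are counted by rows instead of columns. This bounds the total loss of range
  during the elimination.\<close>

lemma sum_card_columns:
  fixes V :: "'i \<Rightarrow> nat set"
  assumes "finite I" "\<And>i. i \<in> I \<Longrightarrow> V i \<subseteq> {..<n}" "\<And>i. i \<in> I \<Longrightarrow> card (V i) \<le> w"
  shows "(\<Sum>j<n. card {i \<in> I. j \<in> V i}) \<le> w * card I"
proof -
  have "(\<Sum>j<n. card {i \<in> I. j \<in> V i}) = (\<Sum>j<n. \<Sum>i\<in>I. if j \<in> V i then 1 else 0)"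
    using assms(1) by (intro sum.cong refl) (simp flip: sum.inter_filter)
  also have "\<dots> = (\<Sum>i\<in>I. \<Sum>j<n. if j \<in> V i then 1 else 0)"
    by (rule sum.swap)
  also have "\<dots> = (\<Sum>i\<in>I. card (V i))"
  proof (rule sum.cong[OF refl])
    fix i assume "i \<in> I"
    then have "{j \<in> {..<n}. j \<in> V i} = V i" using assms(2) by blast
    moreover have "(\<Sum>j<n. if j \<in> V i then 1 else 0) = (\<Sum>j\<in>{j \<in> {..<n}. j \<in> V i}. 1 :: nat)"
      by (rule sum.inter_filter[OF finite_lessThan, symmetric])
    ultimately show "(\<Sum>j<n. if j \<in> V i then 1 else 0) = card (V i)" by simp
  qed
  also have "\<dots> \<le> card I * w" using sum_bounded_above[of I "\<lambda>i. card (V i)" w] assms(3) by simp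
  finally show ?thesis by (simp add: mult.commute)
qed

lemma parity_refutation:
  fixes b :: "'i \<Rightarrow> bit"
  assumes n: "1 \<le> n" and w: "1 \<le> w" and B: "n + 1 \<le> B" "w + 1 \<le> B" "2 ^ w \<le> B"
    and I: "finite I" "card I \<le> n + 1"
    and V: "\<And>i. i \<in> I \<Longrightarrow> V i \<subseteq> {..<n}" "\<And>i. i \<in> I \<Longrightarrow> card (V i) \<le> w"
    and H: "\<And>i T. i \<in> I \<Longrightarrow> T \<subseteq> V i \<Longrightarrow> of_nat (card T) = 1 - b i \<Longrightarrow> parity_clause (V i) T \<in> H"
    and even: "\<And>j. j < n \<Longrightarrow> of_nat (card {i \<in> I. j \<in> V i}) = (0 :: bit)"
    and odd: "sum b I = 1"
  obtains ps where "sa_refutation n H ps" "proof_size ps \<le> 4500 * B ^ 16" "proof_degree ps \<le> w + 5"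
proof -
  define K where "K = 300 * B ^ 13"
  let ?k = "card I"
  let ?d = "\<lambda>j. card {i \<in> I. j \<in> V i}"
  \<comment> \<open>Adding the rows uses up \<open>w * ?k\<close> of the range and the elimination
    at most as much again; \<open>c = 0\<close> survives.\<close>
  let ?R = "2 * (w * ?k)"
  let ?s = "(?k + 1) * ((2 * ?R + 1) * K)"
  have D: "parity_pol V I = (\<Sum>j\<in>{0..<n}. of_nat (?d j) * Var j)"
    using I(1) V(1) by (rule parity_pol_eq_sum)
  have "reachable n H (w + 5) ?s (row_lines V b w ?R I)"
    unfolding K_def by (rule reachable_row_lines[OF n B V H I(1) order_refl])
  \<comment> \<open>As \<open>sum b I = 1\<close>, the condition
    \<open>of_int c = 1 + sum b I\<close> says that \<open>c\<close> is even.\<close>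
  moreover have "parity_line (\<Sum>j\<in>{0..<n}. of_nat (?d j) * Var j) `
      {c. of_int c = (0 :: bit) \<and> \<bar>c\<bar> \<le> int (w * ?k)} \<subseteq> row_lines V b w ?R I"
    unfolding row_lines_def D odd by (intro image_mono) auto
  ultimately have "reachable n H (w + 5) ?s (parity_line (\<Sum>j\<in>{0..<n}. of_nat (?d j) * Var j) `
      {c. of_int c = (0 :: bit) \<and> \<bar>c\<bar> \<le> int (w * ?k)})"
    by (rule reachable_mono) simp
  from reachable_elimination[OF n w B even this order_refl]
  have "reachable n H (w + 5) (?s + n * ((2 * (w * ?k) + 1) * K))
      (parity_line 0 ` {c. of_int c = (0 :: bit) \<and> \<bar>c\<bar> + int (sum ?d {..<n}) \<le> int (w * ?k)})"
    by (simp add: K_def)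
  moreover have "int (sum ?d {..<n}) \<le> int (w * ?k)"
    using sum_card_columns[OF I(1) V] by (simp only: of_nat_le_iff)
  then have "parity_line 0 0 \<in> parity_line 0 `
      {c. of_int c = (0 :: bit) \<and> \<bar>c\<bar> + int (sum ?d {..<n}) \<le> int (w * ?k)}"
    by (intro imageI) simp
  then have "- 1 \<in> parity_line 0 `
      {c. of_int c = (0 :: bit) \<and> \<bar>c\<bar> + int (sum ?d {..<n}) \<le> int (w * ?k)}"
    by (simp add: parity_line_def)
  ultimately obtain ps where ps: "sa_refutation n H ps"
      "proof_size ps \<le> ?s + n * ((2 * (w * ?k) + 1) * K)" "proof_degree ps \<le> w + 5"
    by (rule reachable_refutation)
  have wk: "w * ?k \<le> B * B" using B I(2) by (intro mult_le_mono) auto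
  have B1: "1 \<le> B * B" using B by simp
  have c: "2 * ?R + 1 \<le> 5 * (B * B)" "2 * (w * ?k) + 1 \<le> 5 * (B * B)"
    using wk B1 by linarith+
  have "?s \<le> (2 * B) * ((5 * (B * B)) * K)"
    using c B I(2) n by (intro mult_le_mono order_refl) simp_all
  moreover have "n * ((2 * (w * ?k) + 1) * K) \<le> B * ((5 * (B * B)) * K)"
    using c B by (intro mult_le_mono order_refl) simp_all
  ultimately have "?s + n * ((2 * (w * ?k) + 1) * K) \<le>
      (2 * B) * ((5 * (B * B)) * K) + B * ((5 * (B * B)) * K)"
    by (rule add_le_mono)
  \<comment> \<open>The two phases contribute \<open>10 * B ^ 3 * K\<close> and
    \<open>5 * B ^ 3 * K\<close>, and \<open>15 * 300 = 4500\<close>.\<close>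
  also have "\<dots> = 4500 * (B ^ 3 * B ^ 13)"
    by (simp add: K_def power3_eq_cube mult_ac)
  also have "\<dots> = 4500 * B ^ 16"
    by (simp flip: power_add)
  finally show ?thesis using ps that le_trans by blast
qed

theorem theorem1:
  "\<exists>(q :: real poly poly) (C :: real).
     \<forall>m n :: nat. m \<ge> 1 \<longrightarrow> n \<ge> 1 \<longrightarrow>
       (\<forall>A \<in> carrier_mat m n. \<forall>b \<in> carrier_vec m.
          \<not> (\<exists>x \<in> carrier_vec n. A *\<^sub>v x = b) \<longrightarrow>
          (\<exists>ps. sa_refutation n (enc_system A b) ps \<and>
             real (proof_size ps) \<le> eval2 q (real n) (2 ^ max_row_weight A) \<and>
             real (proof_degree ps) \<le> C * real (max_row_weight A) + C))"
proof -
  \<comment> \<open>The outer variable of \<open>q\<close> stands for \<open>2 ^ w\<close>; its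
    coefficients are polynomials in \<open>n\<close>.\<close>
  define q :: "real poly poly" where "q = Polynomial.monom (Polynomial.smult (4500 * 2 ^ 16) ([:1, 1:] ^ 16)) 16"
  have q: "eval2 q x y = 4500 * 2 ^ 16 * (1 + x) ^ 16 * y ^ 16" for x y
    by (simp add: eval2_def q_def poly_monom poly_power)
  show ?thesis
  proof (intro exI[of _ q] exI[of _ "6 :: real"] allI impI ballI)
    fix m n :: nat and A :: "bit mat" and b :: "bit vec"
    assume m: "m \<ge> 1" and n: "n \<ge> 1" and A: "A \<in> carrier_mat m n" and b: "b \<in> carrier_vec m"
      and unsat: "\<not> (\<exists>x \<in> carrier_vec n. A *\<^sub>v x = b)"
    define w where "w = max_row_weight A"
    \<comment> \<open>The width passed on is \<open>w + 1\<close>, because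
      \<open>parity_refutation\<close> requires a positive width and all rows may be zero. The
      number \<open>B\<close> dominates \<open>n + 1\<close>, this width plus one, and
      \<open>2 ^ (w + 1)\<close>.\<close>
    define B where "B = (n + 1) * 2 ^ (w + 1)"
    define V where "V i = supp (row A i)" for i
    have B: "n + 1 \<le> B" "(w + 1) + 1 \<le> B" "2 ^ (w + 1) \<le> B"
    proof -
      show "n + 1 \<le> B"
        unfolding B_def using mult_le_mono2[of 1 "2 ^ (w + 1)" "n + 1"] by simp
      show "2 ^ (w + 1) \<le> B" by (simp add: B_def)
      then show "(w + 1) + 1 \<le> B" using less_exp[of "w + 1"] by linarith
    qed
    have V_eq: "V i = {j. j < n \<and> A $$ (i, j) = 1}" if "i < m" for i
      using that A by (auto simp: V_def supp_def)
    have card_V: "card (V i) \<le> w + 1" if "i < m" for i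
    proof -
      have "card (V i) \<le> w"
        unfolding w_def max_row_weight_def V_def using that A by (intro Max_ge) auto
      then show ?thesis by simp
    qed
    have "\<nexists>x. \<forall>i<m. (\<Sum>j<n. A $$ (i, j) * x j) = b $ i"
    proof
      assume "\<exists>x. \<forall>i<m. (\<Sum>j<n. A $$ (i, j) * x j) = b $ i"
      then obtain x where x: "\<forall>i<m. (\<Sum>j<n. A $$ (i, j) * x j) = b $ i" by blast
      have "A *\<^sub>v vec n x = b"
        using A b x by (intro eq_vecI) (auto simp: scalar_prod_def lessThan_atLeast0)
      then show False using unsat by auto
    qed
    then obtain I where I: "I \<subseteq> {..<m}" "card I \<le> n + 1"
        "\<And>j. j < n \<Longrightarrow> (\<Sum>i\<in>I. A $$ (i, j)) = 0" "(\<Sum>i\<in>I. b $ i) = 1"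
      by (rule small_unsatisfiable_core) blast
    have fin: "finite I" using I(1) finite_subset by blast
    obtain ps where ps: "sa_refutation n (enc_system A b) ps" "proof_size ps \<le> 4500 * B ^ 16"
        "proof_degree ps \<le> (w + 1) + 5"
    proof (rule parity_refutation[of n "w + 1" B I V "\<lambda>i. b $ i" "enc_system A b"])
      fix j assume j: "j < n"
      have "of_nat (card {i \<in> I. j \<in> V i}) = (\<Sum>i\<in>I. if j \<in> V i then 1 else 0 :: bit)"
        using fin by (simp flip: sum.inter_filter)
      also have "\<dots> = (\<Sum>i\<in>I. A $$ (i, j))"
        using I(1) j by (intro sum.cong) (auto simp: V_eq subset_iff)
      finally show "of_nat (card {i \<in> I. j \<in> V i}) = (0 :: bit)" using I(3)[OF j] by simp
    next
      fix i T assume i: "i \<in> I" and T: "T \<subseteq> V i" "of_nat (card T) = 1 - b $ i"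
      then have "parity_clause (V i) T \<in> enc_row (row A i) (b $ i)"
        unfolding enc_row_def parity_clause_def V_def by blast
      then show "parity_clause (V i) T \<in> enc_system A b"
        using i I(1) A unfolding enc_system_def by auto
    qed (use n B I fin card_V V_eq in \<open>auto simp: subset_iff\<close>)
    have "real (proof_size ps) \<le> real (4500 * B ^ 16)"
      using ps(2) by (rule of_nat_mono)
    also have "\<dots> = 4500 * (2 * (1 + real n) * 2 ^ w) ^ 16"
      by (simp add: B_def algebra_simps)
    also have "\<dots> = eval2 q (real n) (2 ^ w)"
      unfolding q power_mult_distrib by simp
    finally have "real (proof_size ps) \<le> eval2 q (real n) (2 ^ w)" .
    \<comment> \<open>The degree is at most \<open>(w + 1) + 5\<close>, which explains the constant
      6.\<close>
    moreover have "real (proof_degree ps) \<le> 6 * real w + 6"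
      using ps(3) by linarith
    ultimately show "\<exists>ps. sa_refutation n (enc_system A b) ps \<and>
        real (proof_size ps) \<le> eval2 q (real n) (2 ^ max_row_weight A) \<and>
        real (proof_degree ps) \<le> 6 * real (max_row_weight A) + 6"
      using ps(1) unfolding w_def by blast
  qed
qed

end
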